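(* Let $d\ge3$, let $\Omega\subset\mathbb{R}^d$ be a bounded, connected and simply connected Lipschitz domain, and let $\Theta$ be a Lipschitz cluster contained in $\Omega$ in the sense that $\overline\Theta\subset\Omega$. Then for every vector field $\mathbf f\in L^2(\Omega;\mathbb{R}^d)$ there exists a vector field $\mathbf g\in L^2(\Omega\setminus\overline\Theta;\mathbb{R}^d)$ such that $$P_{\Omega^c\leftarrow\Omega}(\mathbf f)=P_{\Omega^c\leftarrow\Omega\setminus\overline\Theta}(\mathbf g).$$
   Context: An open set is Lipschitz if its boundary is compact and, near each boundary point and after a rigid motion, the boundary is the graph of a Lipschitz function. A Lipschitz domain is a connected Lipschitz open set. A Lipschitz cluster is a Lipschitz open set that is a union of finitely many disjoint, bounded and simply connected Lipschitz domains. $\Omega^c:=\mathbb{R}^d\setminus\overline\Omega$. With $N(x)=\frac{1}{(d-2)\omega_d}|x|^{2-d}$, where $\omega_d$ is the area of the unit sphere in $\mathbb{R}^d$, for an open set $U\subset\Omega$ and $\mathbf h\in L^2(U;\mathbb{R}^d)$ the magnetic potential is $P_{\Omega^c\leftarrow U}(\mathbf h)(x)=\int_U\nabla N(x-y)\cdot\mathbf h(y)\,dy$, $x\in\Omega^c$. *)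

theory Defs
  imports "HOL-Analysis.Analysis"
begin

definition rigid_motion :: "(real^'n \<Rightarrow> real^'n) \<Rightarrow> bool" where
  "rigid_motion T \<longleftrightarrow> (\<exists>Q c. orthogonal_transformation Q \<and> T = (\<lambda>x. Q x + c))"

(* The space R^(d-1) is represented by the coordinate hyperplane {z. z $ k = 0} of R^d, so the
   values of phi off this hyperplane play no role. *)
definition coordinate_graph :: "'n \<Rightarrow> (real^'n \<Rightarrow> real) \<Rightarrow> (real^'n) set" where
  "coordinate_graph k \<phi> = {z + \<phi> z *\<^sub>R axis k 1 |z. z $ k = 0}"

(* Only the boundary is required to be a graph near each of its points; that the set lies
   locally on one side of that graph is not assumed. *)
definition lipschitz_open :: "(real^'n) set \<Rightarrow> bool" where
  "lipschitz_open U \<longleftrightarrow> open U \<and> compact (frontier U) \<and>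
     (\<forall>x\<in>frontier U. \<exists>W T k \<phi> L.
        open W \<and> x \<in> W \<and> rigid_motion T \<and> L-lipschitz_on {z. z $ k = 0} \<phi> \<and>
        T ` (frontier U \<inter> W) = coordinate_graph k \<phi> \<inter> T ` W)"

definition lipschitz_domain :: "(real^'n) set \<Rightarrow> bool" where
  "lipschitz_domain U \<longleftrightarrow> connected U \<and> lipschitz_open U"

definition lipschitz_cluster :: "(real^'n) set \<Rightarrow> bool" where
  "lipschitz_cluster U \<longleftrightarrow> lipschitz_open U \<and>
     (\<exists>F. finite F \<and> disjoint F \<and>
        (\<forall>D\<in>F. bounded D \<and> simply_connected D \<and> lipschitz_domain D) \<and> U = \<Union>F)"

(* The area of the unit sphere of R^d, as d times the volume of the unit ball. *)
definition unit_sphere_area :: "'n::finite itself \<Rightarrow> real" where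
  "unit_sphere_area _ = real CARD('n) * measure lborel (ball (0 :: real^'n) 1)"

definition newton_kernel :: "real^'n \<Rightarrow> real" where
  "newton_kernel x =
     1 / ((real CARD('n) - 2) * unit_sphere_area TYPE('n)) * norm x powr (2 - real CARD('n))"

definition gradient :: "(real^'n \<Rightarrow> real) \<Rightarrow> real^'n \<Rightarrow> real^'n" where
  "gradient f x = (THE D. GDERIV f x :> D)"

definition L2_field :: "(real^'n) set \<Rightarrow> (real^'n \<Rightarrow> real^'n) \<Rightarrow> bool" where
  "L2_field U h \<longleftrightarrow> h \<in> borel_measurable (lebesgue_on U) \<and>
     integrable (lebesgue_on U) (\<lambda>y. (norm (h y))\<^sup>2)"

definition magnetic_potential :: "(real^'n) set \<Rightarrow> (real^'n \<Rightarrow> real^'n) \<Rightarrow> real^'n \<Rightarrow> real" where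
  "magnetic_potential U h x =
     integral\<^sup>L (lebesgue_on U) (\<lambda>y. gradient newton_kernel (x - y) \<bullet> h y)"

end

theory Submission
  imports Defs
begin

text \<open>For a point \<open>x\<close> outside \<open>closure \<Omega>\<close> every component of the field \<open>y \<mapsto> \<nabla>N(x - y)\<close> is a bounded
harmonic function of \<open>y\<close> in \<open>\<Omega>\<close>. It therefore suffices to replace every component of \<open>f\<close> on the
compact set \<open>C = closure \<Theta>\<close> by a density on \<open>\<Omega> - C\<close> that has the same integral against all bounded
harmonic functions on \<open>\<Omega>\<close>. This is balayage, and it produces \<open>g\<close> explicitly: \<open>g\<close> is \<open>f\<close> on \<open>\<Omega> - C\<close>
plus the swept density.

The sweeping is done by a random walk with small steps whose law is a radial density \<open>K\<close>. Harmonic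
functions have the mean value property for \<open>K\<close> (\<open>weighted_mean_value\<close>), so along the walk their
integral against the mass is preserved. The walk starts in \<open>C\<close> and is stopped when it has left a
neighbourhood of \<open>C\<close>. Because the mean of \<open>z \<bullet> z\<close> grows by a fixed amount in every step while \<open>\<Omega>\<close> is
bounded, the expected number of steps is finite, so all the mass gets stopped; and because \<open>K\<close> is
bounded, the stopped mass has a bounded density (\<open>sweeping\<close>, \<open>harmonic_balayage\<close>). A bounded density
on a bounded set is square integrable.\<close>

section \<open>Sweeping mass by a stopped random walk\<close>

text \<open>One step of a random walk is described by a Markov kernel \<open>k\<close> with a bounded density. The bound
\<open>B\<close> is what makes the swept measure below a bounded function: after a single step every mass
distribution has a density of size at most \<open>B\<close> times its total mass.\<close>

locale bounded_markov_kernel = sigma_finite_measure +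
  fixes k :: "'a \<Rightarrow> 'a \<Rightarrow> real" and B :: real
  assumes kernel_measurable [measurable]: "case_prod k \<in> borel_measurable (M \<Otimes>\<^sub>M M)"
    and kernel_nonneg: "0 \<le> k y z"
    and kernel_le: "k y z \<le> B"
    and kernel_mass: "y \<in> space M \<Longrightarrow> has_bochner_integral M (k y) 1"
begin

definition transport :: "('a \<Rightarrow> real) \<Rightarrow> 'a \<Rightarrow> real" where
  "transport F z = (\<integral>y. k y z * F y \<partial>M)"

lemma transport_measurable [measurable]:
  assumes [measurable]: "F \<in> borel_measurable M"
  shows "transport F \<in> borel_measurable M"
  unfolding transport_def by measurable

lemma abs_transport_le:
  assumes "integrable M F" "z \<in> space M"
  shows "\<bar>transport F z\<bar> \<le> B * (\<integral>y. \<bar>F y\<bar> \<partial>M)"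
proof -
  have [measurable]: "F \<in> borel_measurable M" using assms by auto
  have le: "\<bar>k y z * F y\<bar> \<le> B * \<bar>F y\<bar>" for y
    using kernel_nonneg[of y z] kernel_le[of y z] by (simp add: abs_mult mult_right_mono)
  have "integrable M (\<lambda>y. k y z * F y)"
    by (rule Bochner_Integration.integrable_bound[where f="\<lambda>y. B * \<bar>F y\<bar>"])
       (use assms le in \<open>auto intro!: AE_I2 order_trans[OF le]\<close>)
  then have "\<bar>transport F z\<bar> \<le> (\<integral>y. B * \<bar>F y\<bar> \<partial>M)"
    unfolding transport_def
    by (intro order_trans[OF integral_abs_bound] integral_mono) (use assms le in auto)
  then show ?thesis by simp
qed

lemma abs_transport_le_transport_abs:
  assumes "integrable M F"
  shows "\<bar>transport F z\<bar> \<le> transport (\<lambda>y. \<bar>F y\<bar>) z"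
  using integral_abs_bound[of M "\<lambda>y. k y z * F y"]
  by (simp add: transport_def abs_mult kernel_nonneg)

text \<open>Averaging a test function with the kernel is the adjoint of transporting a density; this is
Fubini's theorem.\<close>

lemma transport_dual:
  assumes F: "integrable M F"
    and \<phi> [measurable]: "\<phi> \<in> borel_measurable M" and bound: "\<And>z. z \<in> space M \<Longrightarrow> \<bar>\<phi> z\<bar> \<le> H"
  shows "integrable M (\<lambda>z. \<phi> z * transport F z)"
    and "integrable M (\<lambda>y. F y * (\<integral>z. k y z * \<phi> z \<partial>M))"
    and "(\<integral>z. \<phi> z * transport F z \<partial>M) = (\<integral>y. F y * (\<integral>z. k y z * \<phi> z \<partial>M) \<partial>M)"
proof -
  interpret pair_sigma_finite M M ..
  have [measurable]: "F \<in> borel_measurable M" using F by auto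
  let ?g = "\<lambda>y z. k y z * F y * \<phi> z"
  have le: "\<bar>?g y z\<bar> \<le> k y z * (H * \<bar>F y\<bar>)" if "z \<in> space M" for y z
    using mult_left_mono[OF bound[OF that], of "k y z * \<bar>F y\<bar>"] kernel_nonneg[of y z]
    by (simp add: abs_mult ac_simps)
  have int: "integrable M (?g y)" if y: "y \<in> space M" for y
    by (rule Bochner_Integration.integrable_bound[where f="\<lambda>z. k y z * (H * \<bar>F y\<bar>)"])
       (use kernel_mass[OF y] y in
         \<open>auto simp: has_bochner_integral_iff intro!: AE_I2 order_trans[OF le]\<close>)
  have le2: "(\<integral>z. \<bar>?g y z\<bar> \<partial>M) \<le> H * \<bar>F y\<bar>" if y: "y \<in> space M" for y
  proof -
    have "(\<integral>z. \<bar>?g y z\<bar> \<partial>M) \<le> (\<integral>z. k y z * (H * \<bar>F y\<bar>) \<partial>M)"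
      by (rule integral_mono) (use int[OF y] kernel_mass[OF y] le in
           \<open>auto simp: has_bochner_integral_iff\<close>)
    then show ?thesis using kernel_mass[OF y] by (simp add: has_bochner_integral_iff)
  qed
  have prod: "integrable (M \<Otimes>\<^sub>M M) (case_prod ?g)"
  proof (rule Fubini_integrable)
    show "integrable M (\<lambda>y. \<integral>z. norm (case_prod ?g (y, z)) \<partial>M)"
      by (rule Bochner_Integration.integrable_bound[where f="\<lambda>y. H * \<bar>F y\<bar>"])
         (use F le2 in \<open>auto intro!: AE_I2 order_trans[OF le2]\<close>)
    show "AE y in M. integrable M (\<lambda>z. case_prod ?g (y, z))"
      using int by (auto intro!: AE_I2)
  qed measurable
  have 1: "(\<lambda>z. \<integral>y. ?g y z \<partial>M) = (\<lambda>z. \<phi> z * transport F z)"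
    by (auto simp: transport_def mult.commute)
  have 2: "(\<lambda>y. \<integral>z. ?g y z \<partial>M) = (\<lambda>y. F y * (\<integral>z. k y z * \<phi> z \<partial>M))"
    by (simp add: mult.commute mult.left_commute flip: integral_mult_right_zero)
  show "integrable M (\<lambda>z. \<phi> z * transport F z)"
    using integrable_snd[OF prod] unfolding 1 .
  show "integrable M (\<lambda>y. F y * (\<integral>z. k y z * \<phi> z \<partial>M))"
    using integrable_fst[OF prod] unfolding 2 .
  show "(\<integral>z. \<phi> z * transport F z \<partial>M) = (\<integral>y. F y * (\<integral>z. k y z * \<phi> z \<partial>M) \<partial>M)"
    using Fubini_integral[OF prod] unfolding 1 2 .
qed

lemma integrable_transport:
  assumes "integrable M F"
  shows "integrable M (transport F)"
  using transport_dual(1)[OF assms, of "\<lambda>_. 1" 1] by simp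

text \<open>Mass distributed on \<open>A\<close> with density \<open>f\<close> performs the walk and stops on first leaving \<open>A\<close>; the
density \<open>G\<close> of the stopping position has the same integral as \<open>f\<close> against every function with the
mean value property on \<open>A\<close>. Let \<open>F n\<close> be the density still in \<open>A\<close> after \<open>n\<close> steps. The mean value
property makes the integral of \<open>h\<close> against \<open>F n\<close> split into the part that stays in \<open>A\<close> and the
part that stops, so everything rests on the total masses of the \<open>F n\<close> being summable. That is the
finiteness of the expected exit time, and it follows from a Lyapunov function: each step lowers the
mean of the bounded nonnegative function \<open>w\<close> by at least \<open>c\<close>, so the total mass of all \<open>F n\<close>
is at most \<open>1 / c\<close> times the integral of \<open>w\<close> against the absolute value of \<open>f\<close>.\<close>

theorem sweeping:
  assumes A [measurable]: "A \<in> sets M"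
    and w [measurable]: "w \<in> borel_measurable M"
    and w_bounds: "\<And>y. y \<in> space M \<Longrightarrow> 0 \<le> w y" "\<And>y. y \<in> space M \<Longrightarrow> w y \<le> W"
    and c: "0 < c" and drift: "\<And>y. y \<in> A \<Longrightarrow> (\<integral>z. k y z * w z \<partial>M) \<le> w y - c"
    and f: "integrable M f" "\<And>y. y \<notin> A \<Longrightarrow> f y = 0"
  obtains G L where "G \<in> borel_measurable M" "\<And>z. z \<in> space M \<Longrightarrow> \<bar>G z\<bar> \<le> L"
    "\<And>z. z \<in> A \<Longrightarrow> G z = 0"
    "\<And>z. G z \<noteq> 0 \<Longrightarrow> \<exists>y\<in>A. k y z \<noteq> 0"
    "\<And>h H. h \<in> borel_measurable M \<Longrightarrow> (\<And>z. z \<in> space M \<Longrightarrow> \<bar>h z\<bar> \<le> H) \<Longrightarrow>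
       (\<And>y. y \<in> A \<Longrightarrow> (\<integral>z. k y z * h z \<partial>M) = h y) \<Longrightarrow>
       (\<integral>z. h z * G z \<partial>M) = (\<integral>y. h y * f y \<partial>M)"
proof -
  define F where "F = rec_nat f (\<lambda>_ u z. indicator A z * transport u z)"
  have F0: "F 0 = f" and FS: "F (Suc n) = (\<lambda>z. indicator A z * transport (F n) z)" for n
    by (simp_all add: F_def)
  have int: "integrable M (F n)" for n
  proof (induction n)
    case (Suc n)
    have "integrable M (\<lambda>z. indicator A z *\<^sub>R transport (F n) z)"
      by (rule integrable_mult_indicator[OF A integrable_transport[OF Suc]])
    then show ?case by (simp add: FS)
  qed (simp add: F0 f)
  have [measurable]: "F n \<in> borel_measurable M" for n using int by auto
  have zero: "F n y = 0" if "y \<notin> A" for n y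
    using that f by (cases n) (auto simp: F0 FS)
  have AM: "y \<in> space M" if "y \<in> A" for y using that A sets.sets_into_space by blast
  have absw: "\<bar>w y\<bar> \<le> W" if "y \<in> space M" for y using w_bounds[OF that] by auto
  define S where "S n = (\<integral>y. \<bar>F n y\<bar> \<partial>M)" for n
  define a where "a n = (\<integral>y. w y * \<bar>F n y\<bar> \<partial>M)" for n
  have S_nonneg: "0 \<le> S n" for n by (simp add: S_def)
  have intw: "integrable M (\<lambda>y. \<phi> y * F n y)"
    if [measurable]: "\<phi> \<in> borel_measurable M" and "\<And>z. z \<in> space M \<Longrightarrow> \<bar>\<phi> z\<bar> \<le> H" for \<phi> H n
  proof (rule Bochner_Integration.integrable_bound[where f="\<lambda>y. H * F n y"])
    have "\<bar>\<phi> y * F n y\<bar> \<le> \<bar>H * F n y\<bar>" if "y \<in> space M" for y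
      unfolding abs_mult using \<open>\<And>z. z \<in> space M \<Longrightarrow> \<bar>\<phi> z\<bar> \<le> H\<close>[OF that] by (intro mult_right_mono) auto
    then show "AE y in M. norm (\<phi> y * F n y) \<le> norm (H * F n y)" by (auto intro!: AE_I2)
  qed (use int[of n] in auto)
  have intwa: "integrable M (\<lambda>y. w y * \<bar>F n y\<bar>)" for n
  proof -
    have "integrable M (\<lambda>y. \<bar>w y * F n y\<bar>)" using intw[OF w absw] by simp
    then show ?thesis
      by (rule Bochner_Integration.integrable_cong[THEN iffD1, rotated -1])
         (auto simp: abs_mult w_bounds)
  qed
  \<comment> \<open>The \<open>F n\<close> are signed. Their absolute values are not transported exactly, but cancellation and
    stopping only lose mass and \<open>w\<close> is nonnegative, so the drift inequality survives.\<close>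
  have step: "a (Suc n) \<le> a n - c * S n" for n
  proof -
    have ia: "integrable M (\<lambda>y. \<bar>F n y\<bar>)" using int by simp
    note d = transport_dual[OF ia w absw]
    have "a (Suc n) \<le> (\<integral>z. w z * transport (\<lambda>y. \<bar>F n y\<bar>) z \<partial>M)"
      unfolding a_def
    proof (rule integral_mono[OF intwa d(1)])
      fix z assume z: "z \<in> space M"
      have "\<bar>F (Suc n) z\<bar> \<le> transport (\<lambda>y. \<bar>F n y\<bar>) z"
        using abs_transport_le_transport_abs[OF int[of n], of z]
        by (auto simp: FS indicator_def)
      then show "w z * \<bar>F (Suc n) z\<bar> \<le> w z * transport (\<lambda>y. \<bar>F n y\<bar>) z"
        by (rule mult_left_mono) (use w_bounds z in auto)
    qed
    also have "\<dots> = (\<integral>y. \<bar>F n y\<bar> * (\<integral>z. k y z * w z \<partial>M) \<partial>M)" by (rule d(3))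
    also have "\<dots> \<le> (\<integral>y. w y * \<bar>F n y\<bar> - c * \<bar>F n y\<bar> \<partial>M)"
    proof (rule integral_mono[OF d(2)])
      fix y
      show "\<bar>F n y\<bar> * (\<integral>z. k y z * w z \<partial>M) \<le> w y * \<bar>F n y\<bar> - c * \<bar>F n y\<bar>"
      proof (cases "y \<in> A")
        case True
        show ?thesis
          using mult_left_mono[OF drift[OF True], of "\<bar>F n y\<bar>"] by (simp add: algebra_simps)
      qed (simp add: zero)
    qed (use intwa ia in auto)
    also have "\<dots> = a n - c * S n"
      using intwa ia by (simp add: a_def S_def)
    finally show ?thesis .
  qed
  have a_nonneg: "0 \<le> a n" for n
    unfolding a_def
    by (rule Bochner_Integration.integral_nonneg, rule mult_nonneg_nonneg) (use w_bounds in auto)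
  have "summable S"
  proof (rule summableI_nonneg_bounded[OF S_nonneg])
    fix N
    have "c * (\<Sum>n<N. S n) \<le> a 0 - a N"
    proof (induction N)
      case (Suc N) then show ?case using step[of N] by (simp add: distrib_left)
    qed simp
    then show "(\<Sum>n<N. S n) \<le> a 0 / c"
      using a_nonneg[of N] c by (simp add: field_simps)
  qed
  define g where "g n z = indicator (space M - A) z * transport (F n) z" for n z
  have [measurable]: "g n \<in> borel_measurable M" for n unfolding g_def by measurable
  have g_le: "\<bar>g n z\<bar> \<le> B * S n" if "z \<in> space M" for n z
    using abs_transport_le[OF int that, of n] kernel_nonneg[of z z] kernel_le[of z z] S_nonneg[of n]
    by (auto simp: g_def indicator_def S_def intro!: mult_nonneg_nonneg)
  have sumBS: "summable (\<lambda>n. B * S n)" using \<open>summable S\<close> by (rule summable_mult)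
  have sumg: "summable (\<lambda>n. \<bar>g n z\<bar>)" if "z \<in> space M" for z
    by (rule summable_comparison_test'[OF sumBS, of 0]) (use g_le[OF that] in auto)
  define G where "G z = (\<Sum>n. g n z)" for z
  show thesis
  proof (rule that[of G "\<Sum>n. B * S n"])
    show "G \<in> borel_measurable M" unfolding G_def by measurable
    show "\<bar>G z\<bar> \<le> (\<Sum>n. B * S n)" if "z \<in> space M" for z
      unfolding G_def
      by (rule order_trans[OF summable_rabs suminf_le]) (use sumg g_le sumBS that in auto)
    show "G z = 0" if "z \<in> A" for z using that by (simp add: G_def g_def)
    show "\<exists>y\<in>A. k y z \<noteq> 0" if "G z \<noteq> 0" for z
    proof (rule ccontr)
      assume none: "\<not> ?thesis"
      have "(\<lambda>y. k y z * F n y) = (\<lambda>_. 0)" for n using none zero by fastforce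
      then have "transport (F n) z = 0" for n
        by (simp only: transport_def Bochner_Integration.integral_zero)
      then show False using that by (simp add: G_def g_def)
    qed
    fix h H
    assume h [measurable]: "h \<in> borel_measurable M" and hH: "\<And>z. z \<in> space M \<Longrightarrow> \<bar>h z\<bar> \<le> H"
      and mean: "\<And>y. y \<in> A \<Longrightarrow> (\<integral>z. k y z * h z \<partial>M) = h y"
    note d = transport_dual[OF int h hH]
    have hg: "h z * g n z = h z * transport (F n) z - h z * F (Suc n) z" if "z \<in> space M" for n z
      using that by (auto simp: g_def FS indicator_def)
    have intg: "integrable M (\<lambda>z. h z * g n z)" for n
      using Bochner_Integration.integrable_diff[OF d(1)[of n] intw[OF h hH, of "Suc n"]]
      by (rule Bochner_Integration.integrable_cong[THEN iffD1, rotated -1]) (auto simp: hg)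
    have one: "(\<integral>z. h z * g n z \<partial>M) = (\<integral>y. h y * F n y \<partial>M) - (\<integral>y. h y * F (Suc n) y \<partial>M)" for n
    proof -
      have "(\<integral>z. h z * g n z \<partial>M) = (\<integral>z. h z * transport (F n) z - h z * F (Suc n) z \<partial>M)"
        by (rule Bochner_Integration.integral_cong) (auto simp: hg)
      also have "\<dots> = (\<integral>z. h z * transport (F n) z \<partial>M) - (\<integral>y. h y * F (Suc n) y \<partial>M)"
        by (rule Bochner_Integration.integral_diff[OF d(1) intw[OF h hH]])
      also have "(\<integral>z. h z * transport (F n) z \<partial>M) = (\<integral>y. h y * F n y \<partial>M)"
      proof (rule trans[OF d(3) Bochner_Integration.integral_cong[OF refl]])
        fix y
        show "F n y * (\<integral>z. k y z * h z \<partial>M) = h y * F n y"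
          using mean[of y] zero[of y n] by (cases "y \<in> A") auto
      qed
      finally show ?thesis .
    qed
    have "(\<lambda>n. \<integral>y. h y * F n y \<partial>M) \<longlonglongrightarrow> 0"
    proof (rule Lim_null_comparison)
      show "(\<lambda>n. H * S n) \<longlonglongrightarrow> 0"
        using tendsto_mult_right_zero[OF summable_LIMSEQ_zero[OF \<open>summable S\<close>]] .
      have "\<bar>\<integral>y. h y * F n y \<partial>M\<bar> \<le> (\<integral>y. H * \<bar>F n y\<bar> \<partial>M)" for n
        by (intro order_trans[OF integral_abs_bound] integral_mono integrable_abs intw[OF h hH])
           (use int[of n] hH in \<open>auto simp: abs_mult intro!: mult_right_mono\<close>)
      then show "\<forall>\<^sub>F n in sequentially. norm (\<integral>y. h y * F n y \<partial>M) \<le> H * S n"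
        by (simp add: S_def)
    qed
    then have "(\<lambda>n. \<integral>z. h z * g n z \<partial>M) sums ((\<integral>y. h y * F 0 y \<partial>M) - 0)"
      unfolding one by (rule telescope_sums')
    moreover have "(\<lambda>n. \<integral>z. h z * g n z \<partial>M) sums (\<integral>z. (\<Sum>n. h z * g n z) \<partial>M)"
    proof (rule sums_integral[OF intg])
      show "AE z in M. summable (\<lambda>n. norm (h z * g n z))"
        using sumg by (auto intro!: AE_I2 simp: abs_mult)
      have "(\<integral>z. \<bar>h z * g n z\<bar> \<partial>M) \<le> H * S n" for n
      proof -
        have ia: "integrable M (\<lambda>y. \<bar>F n y\<bar>)" using int by simp
        have "(\<integral>z. \<bar>h z * g n z\<bar> \<partial>M) \<le> (\<integral>z. H * transport (\<lambda>y. \<bar>F n y\<bar>) z \<partial>M)"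
        proof (rule integral_mono)
          fix z assume z: "z \<in> space M"
          have "\<bar>g n z\<bar> \<le> transport (\<lambda>y. \<bar>F n y\<bar>) z"
            using abs_transport_le_transport_abs[OF int[of n], of z]
            by (auto simp: g_def indicator_def)
          then show "\<bar>h z * g n z\<bar> \<le> H * transport (\<lambda>y. \<bar>F n y\<bar>) z"
            unfolding abs_mult using hH[OF z] by (intro mult_mono) auto
        qed (use intg[of n] integrable_transport[OF ia] in auto)
        also have "\<dots> = H * S n"
        proof -
          have "(\<integral>z. transport (\<lambda>y. \<bar>F n y\<bar>) z \<partial>M) = (\<integral>y. \<bar>F n y\<bar> * (\<integral>z. k y z \<partial>M) \<partial>M)"
            using transport_dual(3)[OF ia, of "\<lambda>_. 1" 1] by simp
          also have "\<dots> = S n"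
            unfolding S_def by (rule Bochner_Integration.integral_cong)
              (use kernel_mass in \<open>auto simp: has_bochner_integral_iff\<close>)
          finally show ?thesis by simp
        qed
        finally show ?thesis .
      qed
      then show "summable (\<lambda>n. \<integral>z. norm (h z * g n z) \<partial>M)"
        by (intro summable_comparison_test'[OF summable_mult[OF \<open>summable S\<close>, of H], of 0]) auto
    qed
    moreover have "(\<integral>z. (\<Sum>n. h z * g n z) \<partial>M) = (\<integral>z. h z * G z \<partial>M)"
      by (rule Bochner_Integration.integral_cong)
         (auto simp: G_def intro!: suminf_mult summable_rabs_cancel[OF sumg])
    ultimately show "(\<integral>z. h z * G z \<partial>M) = (\<integral>y. h y * f y \<partial>M)"
      using sums_unique2 by (fastforce simp: F0)
  qed
qed

end

section \<open>A weighted mean value property\<close>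

text \<open>The square of this weight is continuously differentiable on the whole space, with gradient \<open>- 4 * paraboloid_cap r u *\<^sub>R u\<close>.
Consequently the mean value property with this weight can be proved by integrations by parts without
boundary terms.\<close>

definition paraboloid_cap :: "real \<Rightarrow> 'a::euclidean_space \<Rightarrow> real" where
  "paraboloid_cap r u = max 0 (r\<^sup>2 - u \<bullet> u)"

lemma paraboloid_cap_nonneg [simp]: "0 \<le> paraboloid_cap r u"
  by (simp add: paraboloid_cap_def)

lemma paraboloid_cap_le: "paraboloid_cap r u \<le> r\<^sup>2"
  by (simp add: paraboloid_cap_def)

lemma paraboloid_cap_eq_0: "0 \<le> r \<Longrightarrow> paraboloid_cap r u = 0 \<longleftrightarrow> r \<le> norm u"
  by (auto simp: paraboloid_cap_def power2_norm_eq_inner[symmetric] max_def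
      intro: power_mono dest: power_mono[of _ _ 2] power2_le_imp_le)

lemma continuous_on_paraboloid_cap [continuous_intros]:
  "continuous_on S f \<Longrightarrow> continuous_on S (\<lambda>x. paraboloid_cap r (f x))"
  unfolding paraboloid_cap_def by (intro continuous_intros)

lemma borel_measurable_paraboloid_cap [measurable]: "paraboloid_cap r \<in> borel_measurable borel"
  by (intro borel_measurable_continuous_onI continuous_intros)

lemma DERIV_max_0_squared: "((\<lambda>s::real. (max 0 s)\<^sup>2) has_field_derivative 2 * max 0 s) (at s)"
proof -
  consider "s > 0" | "s < 0" | "s = 0" by linarith
  then show ?thesis
  proof cases
    case 1
    have "((\<lambda>s::real. s\<^sup>2) has_field_derivative 2 * max 0 s) (at s)"
      using 1 by (auto intro!: derivative_eq_intros)
    then show ?thesis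
      by (rule has_field_derivative_transform_within_open[where S="{0<..}"]) (use 1 in auto)
  next
    case 2
    have "((\<lambda>s::real. 0) has_field_derivative 2 * max 0 s) (at s)"
      using 2 by (auto intro!: derivative_eq_intros)
    then show ?thesis
      by (rule has_field_derivative_transform_within_open[where S="{..<0}"]) (use 2 in auto)
  next
    case 3
    have "((\<lambda>h::real. (max 0 h)\<^sup>2 / h) \<longlongrightarrow> 0) (at 0)"
    proof (rule Lim_null_comparison)
      show "\<forall>\<^sub>F h::real in at 0. norm ((max 0 h)\<^sup>2 / h) \<le> \<bar>h\<bar>"
        by (rule always_eventually) (auto simp: max_def power2_eq_square)
      show "((\<lambda>h::real. \<bar>h\<bar>) \<longlongrightarrow> 0) (at 0)"
        by (rule tendsto_eq_intros | simp)+
    qed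
    then show ?thesis using 3 by (simp add: has_field_derivative_iff)
  qed
qed

lemma DERIV_paraboloid_cap_squared:
  "((\<lambda>t. (paraboloid_cap r (u + t *\<^sub>R v))\<^sup>2) has_field_derivative
     - 4 * paraboloid_cap r (u + t *\<^sub>R v) * ((u + t *\<^sub>R v) \<bullet> v)) (at t)"
proof -
  have *: "((\<lambda>t. r\<^sup>2 - (u + t *\<^sub>R v) \<bullet> (u + t *\<^sub>R v)) has_field_derivative
      - 2 * ((u + t *\<^sub>R v) \<bullet> v)) (at t)"
    unfolding has_field_derivative_def
    by (auto intro!: derivative_eq_intros simp: inner_commute algebra_simps)
  show ?thesis
    using DERIV_chain[OF DERIV_max_0_squared *]
    by (simp add: paraboloid_cap_def o_def algebra_simps)
qed


text \<open>Integrals run over cubes rather than balls so that differentiation under the integral takes place on a box; the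
weight vanishes off the inscribed ball, so the shape of the domain does not matter.\<close>

abbreviation cube :: "real \<Rightarrow> 'a::euclidean_space set" where
  "cube s \<equiv> cbox (- (s *\<^sub>R One)) (s *\<^sub>R One)"

lemma mem_cube: "u \<in> cube s \<longleftrightarrow> (\<forall>b\<in>Basis. \<bar>u \<bullet> b\<bar> \<le> s)"
  by (auto simp: mem_box abs_le_iff)

lemma norm_gt_if_notin_cube: "u \<notin> cube s \<Longrightarrow> s < norm u"
  unfolding mem_cube using Basis_le_norm order_less_le_trans by (metis not_le)

lemma norm_le_if_in_cube: "(u :: 'a::euclidean_space) \<in> cube s \<Longrightarrow> norm u \<le> real DIM('a) * s"
  unfolding mem_cube
  by (rule order_trans[OF norm_le_l1 sum_bounded_above]) auto

lemma integral_cube_translate: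
  fixes F :: "'a::euclidean_space \<Rightarrow> real"
  assumes "\<And>u. r \<le> norm u \<Longrightarrow> F u = 0" and "0 \<le> r" "norm v \<le> r"
    and F: "F integrable_on cube (2 * r)"
  shows "integral (cube (2 * r)) (\<lambda>u. F (u + v)) = integral (cube (2 * r)) F"
proof -
  let ?Q = "cube (2 * r) :: 'a set" and ?I = "integral (cube (2 * r)) F"
  have "(F has_integral ?I) ?Q"
    using F by blast
  then have "((\<lambda>u. F (u + v)) has_integral ?I) ((\<lambda>u. u - v) ` ?Q)"
    using has_integral_affinity[where m=1 and c=v and f=F] by simp
  then have "((\<lambda>u. F (u + v)) has_integral ?I) UNIV"
  proof (rule has_integral_on_superset)
    fix u assume "u \<notin> (\<lambda>u. u - v) ` ?Q"
    then have "u + v \<notin> ?Q" by (metis add_diff_cancel_right' image_eqI)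
    then have "2 * r < norm (u + v)" by (rule norm_gt_if_notin_cube)
    then show "F (u + v) = 0" using assms(1)[of "u + v"] \<open>0 \<le> r\<close> by linarith
  qed simp
  moreover have "F (u + v) = 0" if "u \<notin> ?Q" for u
    using norm_gt_if_notin_cube[OF that] norm_diff_ineq[of u v] assms(1)[of "u + v"] \<open>norm v \<le> r\<close>
    by linarith
  then have "(\<lambda>u. if u \<in> ?Q then F (u + v) else 0) = (\<lambda>u. F (u + v))"
    by auto
  ultimately have "((\<lambda>u. F (u + v)) has_integral ?I) ?Q"
    using has_integral_restrict_UNIV[of ?Q "\<lambda>u. F (u + v)" ?I] by simp
  then show ?thesis by (rule integral_unique)
qed

text \<open>The integral of \<open>F\<close> over a large cube does not change when \<open>F\<close> is translated, and the derivative of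
the translated integral at \<open>0\<close> is the integral of the partial derivative. Translation by at most
\<open>r\<close> moves the cube of radius \<open>2 * r\<close> into the one of radius \<open>3 * r\<close>, where smoothness is assumed.\<close>

lemma integral_partial_derivative_eq_0:
  fixes F F' :: "'a::euclidean_space \<Rightarrow> real"
  assumes r: "0 < r" and zero: "\<And>u. r \<le> norm u \<Longrightarrow> F u = 0" and b: "b \<in> Basis"
    and F: "continuous_on (cube (3 * r)) F" and F': "continuous_on (cube (3 * r)) F'"
    and deriv: "\<And>u t. u + t *\<^sub>R b \<in> cube (3 * r) \<Longrightarrow>
      ((\<lambda>t. F (u + t *\<^sub>R b)) has_field_derivative F' (u + t *\<^sub>R b)) (at t)"
  shows "integral (cube (2 * r)) F' = 0"
proof -
  let ?Q = "cube (2 * r) :: 'a set"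
  have sub: "u + t *\<^sub>R b \<in> cube (3 * r)" if "u \<in> ?Q" "t \<in> {-r..r}" for u t
    unfolding mem_cube
  proof
    fix b' :: 'a assume b': "b' \<in> Basis"
    have "\<bar>u \<bullet> b'\<bar> \<le> 2 * r" using that b' by (auto simp: mem_cube)
    moreover have "\<bar>t *\<^sub>R b \<bullet> b'\<bar> \<le> r" using that r b b' by (auto simp: inner_Basis)
    ultimately show "\<bar>(u + t *\<^sub>R b) \<bullet> b'\<bar> \<le> 3 * r" by (simp add: inner_add_left)
  qed
  have "((\<lambda>t. integral ?Q (\<lambda>u. F (u + t *\<^sub>R b))) has_field_derivative
      integral ?Q (\<lambda>u. F' (u + 0 *\<^sub>R b))) (at 0 within {-r..r})"
  proof (rule leibniz_rule_field_derivative)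
    show "(\<lambda>u. F (u + t *\<^sub>R b)) integrable_on ?Q" if "t \<in> {-r..r}" for t
      by (intro integrable_continuous continuous_on_compose2[OF F] continuous_intros)
         (use sub that in auto)
    show "continuous_on ({-r..r} \<times> ?Q) (\<lambda>(t, u). F' (u + t *\<^sub>R b))"
      unfolding split_beta
      by (intro continuous_on_compose2[OF F'] continuous_intros) (use sub in auto)
  qed (use r sub deriv in \<open>auto intro: has_field_derivative_at_within\<close>)
  moreover have "integral ?Q (\<lambda>u. F (u + t *\<^sub>R b)) = integral ?Q F" if "t \<in> {-r..r}" for t
  proof (rule integral_cube_translate[OF zero])
    have "continuous_on ?Q F"
      by (rule continuous_on_subset[OF F]) (use sub[of _ 0] r in auto)
    then show "F integrable_on ?Q" by (rule integrable_continuous)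
  qed (use that r b in auto)
  ultimately have "((\<lambda>t. integral ?Q F) has_field_derivative integral ?Q F') (at 0 within {-r..r})"
    using r by (subst (asm) has_field_derivative_cong_eventually[where g="\<lambda>t. integral ?Q F"])
      (auto simp: eventually_at_filter)
  then have "((\<lambda>t. integral ?Q F) has_field_derivative integral ?Q F') (at 0)"
    using r by (simp add: at_within_Icc_at)
  then show ?thesis
    using DERIV_unique DERIV_const by blast
qed

text \<open>Here \<open>G\<close> is the gradient of \<open>h\<close>, \<open>DG\<close> its Hessian and the hypothesis on the trace says that \<open>h\<close>
is harmonic. Contract the argument of \<open>h\<close> to \<open>y + s *\<^sub>R u\<close> with \<open>s\<close> in \<open>{0..1}\<close>. The derivative in \<open>s\<close>
of the weighted integral is the integral of \<open>paraboloid_cap r u * (u \<bullet> G (y + s *\<^sub>R u))\<close>. Since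
\<open>paraboloid_cap r u *\<^sub>R u\<close> is a multiple of the gradient of the squared weight, an integration by
parts turns this into an integral of the Laplacian of \<open>h\<close>, which is zero. So the weighted integral
is the same for \<open>s = 1\<close> as for \<open>s = 0\<close>.\<close>

theorem weighted_mean_value:
  fixes h :: "'a::euclidean_space \<Rightarrow> real" and G :: "'a \<Rightarrow> 'a" and DG :: "'a \<Rightarrow> 'a \<Rightarrow> 'a"
    and r e :: real
  assumes r: "0 < r" and e: "real DIM('a) * (3 * r) \<le> e"
    and h: "\<And>x. x \<in> cball y e \<Longrightarrow> (h has_derivative (\<lambda>v. v \<bullet> G x)) (at x)"
    and G: "\<And>x. x \<in> cball y e \<Longrightarrow> (G has_derivative DG x) (at x)"
    and cont: "\<And>b. b \<in> Basis \<Longrightarrow> continuous_on (cball y e) (\<lambda>x. DG x b \<bullet> b)"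
    and harmonic: "\<And>x. x \<in> cball y e \<Longrightarrow> (\<Sum>b\<in>Basis. DG x b \<bullet> b) = 0"
  shows "integral (cube (2 * r)) (\<lambda>u. paraboloid_cap r u * h (y + u)) =
    integral (cube (2 * r)) (paraboloid_cap r :: 'a \<Rightarrow> real) * h y"
proof -
  let ?Q = "cube (2 * r) :: 'a set"
  let ?\<psi> = "paraboloid_cap r :: 'a \<Rightarrow> real"
  have in_ball: "y + s *\<^sub>R u \<in> cball y e" if "u \<in> cube (3 * r)" "s \<in> {0..1}" for u s
  proof -
    have "\<bar>s\<bar> * norm u \<le> 1 * norm u" using that(2) by (intro mult_right_mono) auto
    then have "norm (s *\<^sub>R u) \<le> e" using norm_le_if_in_cube[OF that(1)] e by simp
    then show ?thesis by (simp add: dist_norm)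
  qed
  have QQ: "?Q \<subseteq> cube (3 * r)" using r by (intro subset_box_imp) auto
  have contG: "continuous_on (cball y e) G" and conth: "continuous_on (cball y e) h"
    using G h by (meson has_derivative_continuous continuous_at_imp_continuous_on)+
  have flat: "integral ?Q (\<lambda>u. ?\<psi> u * (u \<bullet> G (y + s *\<^sub>R u))) = 0" if s: "s \<in> {0..1}" for s
  proof -
    \<comment> \<open>\<open>F' b\<close> is the partial derivative in direction \<open>b\<close> of the squared weight times the \<open>b\<close>-component
      of the gradient of \<open>h\<close>; summing over \<open>b\<close> gives the divergence.\<close>
    define F' where "F' b u = - 4 * ?\<psi> u * (u \<bullet> b) * (G (y + s *\<^sub>R u) \<bullet> b) +
      (?\<psi> u)\<^sup>2 * (s * (DG (y + s *\<^sub>R u) b \<bullet> b))" for b u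
    have contF': "continuous_on (cube (3 * r)) (F' b)" if "b \<in> Basis" for b
      unfolding F'_def
      by (intro continuous_intros continuous_on_compose2[OF contG] continuous_on_compose2[OF cont[OF that]])
         (use in_ball s in auto)
    have "integral ?Q (F' b) = 0" if b: "b \<in> Basis" for b
    proof (rule integral_partial_derivative_eq_0[OF r _ b _ contF'[OF b], where F = "\<lambda>u. (?\<psi> u)\<^sup>2 * (G (y + s *\<^sub>R u) \<bullet> b)"])
      show "continuous_on (cube (3 * r)) (\<lambda>u. (?\<psi> u)\<^sup>2 * (G (y + s *\<^sub>R u) \<bullet> b))"
        by (intro continuous_intros continuous_on_compose2[OF contG]) (use in_ball s in auto)
    next
      fix u t assume ut: "u + t *\<^sub>R b \<in> cube (3 * r)"
      have lin: "linear (DG (y + s *\<^sub>R (u + t *\<^sub>R b)))"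
        using G[OF in_ball[OF ut s]] has_derivative_linear by blast
      have inner: "((\<lambda>t. y + s *\<^sub>R (u + t *\<^sub>R b)) has_derivative (\<lambda>\<tau>. s *\<^sub>R (\<tau> *\<^sub>R b))) (at t)"
        by (auto intro!: derivative_eq_intros)
      have "((\<lambda>t. G (y + s *\<^sub>R (u + t *\<^sub>R b)) \<bullet> b) has_derivative
          (\<lambda>\<tau>. DG (y + s *\<^sub>R (u + t *\<^sub>R b)) (s *\<^sub>R (\<tau> *\<^sub>R b)) \<bullet> b)) (at t)"
        by (rule has_derivative_inner_left[OF has_derivative_compose[OF inner G[OF in_ball[OF ut s]]]])
      then have "((\<lambda>t. G (y + s *\<^sub>R (u + t *\<^sub>R b)) \<bullet> b) has_field_derivative
          s * (DG (y + s *\<^sub>R (u + t *\<^sub>R b)) b \<bullet> b)) (at t)"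
        unfolding has_field_derivative_def
        by (rule has_derivative_eq_rhs) (auto simp: linear_cmul[OF lin])
      from DERIV_mult'[OF DERIV_paraboloid_cap_squared[of r u b t] this]
      show "((\<lambda>t. (?\<psi> (u + t *\<^sub>R b))\<^sup>2 * (G (y + s *\<^sub>R (u + t *\<^sub>R b)) \<bullet> b)) has_field_derivative
          F' b (u + t *\<^sub>R b)) (at t)"
        by (rule DERIV_cong) (simp add: F'_def)
    qed (use r in \<open>simp add: paraboloid_cap_eq_0\<close>)
    moreover have "integral ?Q (\<lambda>u. \<Sum>b\<in>Basis. F' b u) = (\<Sum>b\<in>Basis. integral ?Q (F' b))"
      by (rule integral_sum)
         (auto intro!: integrable_continuous intro: continuous_on_subset[OF contF' QQ])
    ultimately have "integral ?Q (\<lambda>u. \<Sum>b\<in>Basis. F' b u) = 0" by simp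
    moreover have "(\<Sum>b\<in>Basis. F' b u) = - 4 * (?\<psi> u * (u \<bullet> G (y + s *\<^sub>R u)))" if "u \<in> ?Q" for u
    proof -
      have "(\<Sum>b\<in>Basis. DG (y + s *\<^sub>R u) b \<bullet> b) = 0"
        by (rule harmonic, rule in_ball) (use that QQ s in auto)
      moreover have "(\<Sum>b\<in>Basis. F' b u) =
          - 4 * ?\<psi> u * (\<Sum>b\<in>Basis. (u \<bullet> b) * (G (y + s *\<^sub>R u) \<bullet> b)) +
          (?\<psi> u)\<^sup>2 * s * (\<Sum>b\<in>Basis. DG (y + s *\<^sub>R u) b \<bullet> b)"
        unfolding F'_def sum.distrib sum_distrib_left by (simp add: mult.assoc)
      ultimately show ?thesis
        by (simp flip: euclidean_inner)
    qed
    then have "integral ?Q (\<lambda>u. \<Sum>b\<in>Basis. F' b u) =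
        integral ?Q (\<lambda>u. - 4 * (?\<psi> u * (u \<bullet> G (y + s *\<^sub>R u))))"
      by (rule Henstock_Kurzweil_Integration.integral_cong)
    ultimately show ?thesis by simp
  qed
  define \<phi> where "\<phi> s = integral ?Q (\<lambda>u. ?\<psi> u * h (y + s *\<^sub>R u))" for s
  have "(\<phi> has_field_derivative 0) (at s within {0..1})" if s: "s \<in> {0..1}" for s
    unfolding \<phi>_def
  proof (rule DERIV_cong[OF _ flat[OF s]], rule leibniz_rule_field_derivative)
    fix s u assume su: "s \<in> {0..1::real}" "u \<in> ?Q"
    have inner: "((\<lambda>s. y + s *\<^sub>R u) has_derivative (\<lambda>\<tau>. \<tau> *\<^sub>R u)) (at s within {0..1})"
      by (auto intro!: derivative_eq_intros)
    have "((\<lambda>s. h (y + s *\<^sub>R u)) has_field_derivative (u \<bullet> G (y + s *\<^sub>R u))) (at s within {0..1})"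
      using has_derivative_compose[OF inner h[OF in_ball]] su QQ
      by (auto simp: has_field_derivative_def mult.commute[of _ "u \<bullet> _"])
    then show "((\<lambda>s. ?\<psi> u * h (y + s *\<^sub>R u)) has_field_derivative ?\<psi> u * (u \<bullet> G (y + s *\<^sub>R u)))
        (at s within {0..1})"
      by (rule DERIV_cmult)
  next
    show "(\<lambda>u. ?\<psi> u * h (y + s *\<^sub>R u)) integrable_on ?Q" if "s \<in> {0..1}" for s
      by (intro integrable_continuous continuous_intros continuous_on_compose2[OF conth])
         (use in_ball that QQ in auto)
    show "continuous_on ({0..1} \<times> ?Q) (\<lambda>(s, u). ?\<psi> u * (u \<bullet> G (y + s *\<^sub>R u)))"
      unfolding split_beta
      by (intro continuous_intros continuous_on_compose2[OF contG]) (use in_ball QQ in auto)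
  qed (use s in auto)
  then obtain c where "\<And>s. s \<in> {0..1} \<Longrightarrow> \<phi> s = c"
    using has_field_derivative_zero_constant[of "{0..1}" \<phi>] by auto
  then have "\<phi> 1 = \<phi> 0" by simp
  then show ?thesis by (simp add: \<phi>_def)
qed

section \<open>Balayage for harmonic functions\<close>

text \<open>The trace of the Hessian \<open>DG x\<close> is the Laplacian. Only the diagonal entries of the Hessian are
required to be continuous, since only they occur in the integration by parts. The derivatives are
full ones at every point of \<open>S\<close>, also when \<open>S\<close> is not open.\<close>

definition harmonic_on :: "'a::euclidean_space set \<Rightarrow> ('a \<Rightarrow> real) \<Rightarrow> bool" where
  "harmonic_on S h \<longleftrightarrow> (\<exists>G DG.
     (\<forall>x\<in>S. (h has_derivative (\<lambda>v. v \<bullet> G x)) (at x) \<and> (G has_derivative DG x) (at x) \<and>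
        (\<Sum>b\<in>Basis. DG x b \<bullet> b) = 0) \<and>
     (\<forall>b\<in>Basis. continuous_on S (\<lambda>x. DG x b \<bullet> b)))"

lemma harmonic_onE:
  assumes "harmonic_on S h"
  obtains G DG where "\<And>x. x \<in> S \<Longrightarrow> (h has_derivative (\<lambda>v. v \<bullet> G x)) (at x)"
    "\<And>x. x \<in> S \<Longrightarrow> (G has_derivative DG x) (at x)"
    "\<And>b. b \<in> Basis \<Longrightarrow> continuous_on S (\<lambda>x. DG x b \<bullet> b)"
    "\<And>x. x \<in> S \<Longrightarrow> (\<Sum>b\<in>Basis. DG x b \<bullet> b) = 0"
  using assms unfolding harmonic_on_def by blast

lemma harmonic_onI:
  assumes "\<And>x. x \<in> S \<Longrightarrow> (h has_derivative (\<lambda>v. v \<bullet> G x)) (at x)"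
    "\<And>x. x \<in> S \<Longrightarrow> (G has_derivative DG x) (at x)"
    "\<And>b. b \<in> Basis \<Longrightarrow> continuous_on S (\<lambda>x. DG x b \<bullet> b)"
    "\<And>x. x \<in> S \<Longrightarrow> (\<Sum>b\<in>Basis. DG x b \<bullet> b) = 0"
  shows "harmonic_on S h"
  unfolding harmonic_on_def
  by (rule exI[of _ G], rule exI[of _ DG]) (simp add: assms)

lemma harmonic_on_subset:
  assumes "harmonic_on S h" "T \<subseteq> S" shows "harmonic_on T h"
  using assms(1)
proof (rule harmonic_onE)
  fix G DG
  assume *: "\<And>x. x \<in> S \<Longrightarrow> (h has_derivative (\<lambda>v. v \<bullet> G x)) (at x)"
    "\<And>x. x \<in> S \<Longrightarrow> (G has_derivative DG x) (at x)"
    "\<And>b. b \<in> Basis \<Longrightarrow> continuous_on S (\<lambda>x. DG x b \<bullet> b)"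
    "\<And>x. x \<in> S \<Longrightarrow> (\<Sum>b\<in>Basis. DG x b \<bullet> b) = 0"
  show ?thesis
    by (rule harmonic_onI[OF *(1,2) continuous_on_subset[OF *(3) assms(2)] *(4)])
       (use assms(2) in auto)
qed

lemma harmonic_on_imp_continuous_on:
  assumes "harmonic_on S h" shows "continuous_on S h"
  using assms
  by (rule harmonic_onE) (blast intro: continuous_at_imp_continuous_on has_derivative_continuous)

lemma harmonic_on_cong:
  assumes "harmonic_on S h" "open S" "\<And>x. x \<in> S \<Longrightarrow> h x = h' x"
  shows "harmonic_on S h'"
  using assms(1)
proof (rule harmonic_onE)
  fix G DG
  assume *: "\<And>x. x \<in> S \<Longrightarrow> (h has_derivative (\<lambda>v. v \<bullet> G x)) (at x)"
    "\<And>x. x \<in> S \<Longrightarrow> (G has_derivative DG x) (at x)"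
    "\<And>b. b \<in> Basis \<Longrightarrow> continuous_on S (\<lambda>x. DG x b \<bullet> b)"
    "\<And>x. x \<in> S \<Longrightarrow> (\<Sum>b\<in>Basis. DG x b \<bullet> b) = 0"
  show ?thesis
    by (rule harmonic_onI[OF has_derivative_transform_within_open[OF *(1) assms(2) _ assms(3)] *(2-4)])
qed

lemma harmonic_on_inner_left: "harmonic_on S (\<lambda>x. x \<bullet> a)"
  unfolding harmonic_on_def
  by (rule exI[of _ "\<lambda>_. a"], rule exI[of _ "\<lambda>_ _. 0"]) (auto intro!: derivative_eq_intros)

lemma harmonic_on_const: "harmonic_on S (\<lambda>x. c)"
  unfolding harmonic_on_def
  by (rule exI[of _ "\<lambda>_. 0"], rule exI[of _ "\<lambda>_ _. 0"]) (auto intro!: derivative_eq_intros)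

lemma integral_cube_eq_lborel:
  fixes f :: "'a::euclidean_space \<Rightarrow> real"
  assumes "integrable lborel f" "\<And>u. u \<notin> cube s \<Longrightarrow> f u = 0"
  shows "integral (cube s) f = (\<integral>u. f u \<partial>lborel)"
proof -
  have "(\<lambda>u. if u \<in> cube s then f u else 0) = f" using assms(2) by auto
  then show ?thesis
    using integral_restrict_UNIV[of "cube s" f] integral_lborel[OF assms(1)] by simp
qed

lemma lborel_has_bochner_integral_translate:
  fixes f :: "'a::euclidean_space \<Rightarrow> real"
  assumes [measurable]: "f \<in> borel_measurable borel"
  shows "has_bochner_integral lborel (\<lambda>u. f (y + u)) x \<longleftrightarrow> has_bochner_integral lborel f x"
  unfolding has_bochner_integral_iff
  using integrable_distr_eq[of "(+) y" lborel borel f] integral_distr[of "(+) y" lborel borel f]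
  by (simp add: lborel_distr_plus)

lemma paraboloid_cap_zero_off_cube:
  assumes "0 < r" "u \<notin> cube (2 * r)" shows "paraboloid_cap r u = 0"
  using norm_gt_if_notin_cube[OF assms(2)] assms(1) by (simp add: paraboloid_cap_eq_0)

lemma integrable_paraboloid_cap_mult:
  fixes g :: "'a::euclidean_space \<Rightarrow> real"
  assumes r: "0 < r" and g: "continuous_on (cube (2 * r)) g"
  shows "integrable lborel (\<lambda>u. paraboloid_cap r u * g u)"
proof -
  have eq: "(\<lambda>u. indicator (cube (2 * r)) u *\<^sub>R (paraboloid_cap r u * g u)) =
      (\<lambda>u. paraboloid_cap r u * g u)"
    by (rule ext) (simp add: paraboloid_cap_zero_off_cube[OF r] split: split_indicator)
  have "continuous_on (cube (2 * r)) (\<lambda>u. paraboloid_cap r u * g u)"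
    by (intro continuous_intros g)
  then have "integrable lborel (\<lambda>u. indicator (cube (2 * r)) u *\<^sub>R (paraboloid_cap r u * g u))"
    by (rule borel_integrable_compact[OF compact_cbox])
  then show ?thesis unfolding eq .
qed

lemma integral_paraboloid_cap_pos:
  assumes r: "0 < r"
  shows "0 < (\<integral>u. paraboloid_cap r (u::'a::euclidean_space) \<partial>lborel)"
proof -
  have int: "integrable lborel (paraboloid_cap r :: 'a \<Rightarrow> real)"
    using integrable_paraboloid_cap_mult[OF r continuous_on_const[of _ 1]] by simp
  have "\<not> (AE u::'a in lborel. paraboloid_cap r u = 0)"
  proof
    assume "AE u::'a in lborel. paraboloid_cap r u = 0"
    then have "AE u::'a in lebesgue. u \<in> {u. paraboloid_cap r u = 0}"
      by (simp add: AE_completion)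
    moreover have "closed {u::'a. paraboloid_cap r u = 0}"
      by (intro closed_Collect_eq continuous_intros)
    ultimately have "(0::'a) \<in> {u. paraboloid_cap r u = 0}"
      by (rule mem_closed_if_AE_lebesgue[rotated])
    then show False using r by (simp add: paraboloid_cap_def)
  qed
  then show ?thesis
    using integral_nonneg_eq_0_iff_AE[OF int] Bochner_Integration.integral_nonneg[of lborel "paraboloid_cap r :: 'a \<Rightarrow> real"]
    by (simp add: order_less_le)
qed

definition cap_kernel :: "real \<Rightarrow> 'a::euclidean_space \<Rightarrow> 'a \<Rightarrow> real" where
  "cap_kernel r y z =
     paraboloid_cap r (z - y) / (\<integral>u. paraboloid_cap r (u::'a) \<partial>lborel)"

lemma cap_kernel_eq_0: "r \<le> dist y z \<Longrightarrow> 0 < r \<Longrightarrow> cap_kernel r y z = 0"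
  by (simp add: cap_kernel_def paraboloid_cap_eq_0 dist_norm norm_minus_commute)

lemma harmonic_cap_mean:
  fixes h :: "'a::euclidean_space \<Rightarrow> real"
  assumes r: "0 < r" and [measurable]: "h \<in> borel_measurable borel"
    and h: "harmonic_on (cball y (real DIM('a) * (3 * r))) h"
  shows "has_bochner_integral lborel (\<lambda>z. cap_kernel r y z * h z) (h y)"
proof -
  let ?m = "\<integral>u. paraboloid_cap r (u::'a) \<partial>lborel"
  have m: "0 < ?m" by (rule integral_paraboloid_cap_pos[OF r])
  have int1: "integrable lborel (paraboloid_cap r :: 'a \<Rightarrow> real)"
    using integrable_paraboloid_cap_mult[OF r continuous_on_const[of _ 1]] by simp
  have "continuous_on (cube (2 * r)) (\<lambda>u. h (y + u))"
  proof (rule continuous_on_compose2[OF harmonic_on_imp_continuous_on[OF h]])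
    show "(\<lambda>u. y + u) ` cube (2 * r) \<subseteq> cball y (real DIM('a) * (3 * r))"
    proof clarify
      fix u :: 'a assume "u \<in> cube (2 * r)"
      then have "norm u \<le> real DIM('a) * (2 * r)" by (rule norm_le_if_in_cube)
      also have "\<dots> \<le> real DIM('a) * (3 * r)" using r by (intro mult_left_mono) auto
      finally show "y + u \<in> cball y (real DIM('a) * (3 * r))" by (simp add: dist_norm)
    qed
  qed (intro continuous_intros)
  then have int: "integrable lborel (\<lambda>u. paraboloid_cap r u * h (y + u))"
    by (rule integrable_paraboloid_cap_mult[OF r])
  from h have "integral (cube (2 * r)) (\<lambda>u. paraboloid_cap r u * h (y + u)) =
      integral (cube (2 * r)) (paraboloid_cap r :: 'a \<Rightarrow> real) * h y"
    by (rule harmonic_onE) (rule weighted_mean_value[OF r order_refl])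
  then have "(\<integral>u. paraboloid_cap r u * h (y + u) \<partial>lborel) = ?m * h y"
    by (simp add: integral_cube_eq_lborel[OF int, of "2 * r"]
        integral_cube_eq_lborel[OF int1, of "2 * r"] paraboloid_cap_zero_off_cube[OF r])
  then have "has_bochner_integral lborel (\<lambda>u. paraboloid_cap r u * h (y + u)) (?m * h y)"
    using int by (simp add: has_bochner_integral_iff)
  from has_bochner_integral_divide_zero[OF this, of ?m]
  have "has_bochner_integral lborel (\<lambda>u. cap_kernel r y (y + u) * h (y + u)) (h y)"
    using m by (simp add: cap_kernel_def)
  moreover have "(\<lambda>z. cap_kernel r y z * h z) \<in> borel_measurable borel"
    unfolding cap_kernel_def by measurable
  ultimately show ?thesis
    using lborel_has_bochner_integral_translate[of "\<lambda>z. cap_kernel r y z * h z" y "h y"] by simp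
qed

lemma bounded_markov_kernel_cap_kernel:
  assumes r: "0 < r"
  shows "bounded_markov_kernel lborel (cap_kernel r :: 'a::euclidean_space \<Rightarrow> 'a \<Rightarrow> real)
    (r\<^sup>2 / (\<integral>u. paraboloid_cap r (u::'a) \<partial>lborel))"
proof
  note m = integral_paraboloid_cap_pos[where 'a='a, OF r]
  show "case_prod (cap_kernel r) \<in> borel_measurable (lborel \<Otimes>\<^sub>M (lborel :: 'a measure))"
    unfolding cap_kernel_def split_beta by measurable
  show "0 \<le> cap_kernel r y z" for y z :: 'a
    using m by (simp add: cap_kernel_def)
  show "cap_kernel r y z \<le> r\<^sup>2 / (\<integral>u. paraboloid_cap r (u::'a) \<partial>lborel)" for y z :: 'a
    unfolding cap_kernel_def using m by (intro divide_right_mono paraboloid_cap_le) auto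
  show "has_bochner_integral lborel (cap_kernel r y) 1" for y :: 'a
    using harmonic_cap_mean[OF r _ harmonic_on_const[of _ 1], of y] by simp
qed

text \<open>The mass of \<open>f\<close> on \<open>C\<close> is swept into \<open>\<Omega> - C\<close>. The walk takes steps of length less than \<open>r\<close> and is
stopped on leaving a neighbourhood \<open>A\<close> of \<open>C\<close>; the radius is so small that it still is in \<open>\<Omega>\<close> then,
and that the mean value property can be applied around every point of \<open>A\<close>. The Lyapunov function is
\<open>R\<^sup>2 - z \<bullet> z\<close>: one step started at \<open>y\<close> raises the mean of \<open>z \<bullet> z\<close> by the second moment of the kernel.
The density \<open>G\<close> does not depend on the harmonic function \<open>h\<close> against which it is tested.\<close>

theorem harmonic_balayage:
  fixes \<Omega> C :: "'a::euclidean_space set"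
  assumes \<Omega>: "open \<Omega>" "bounded \<Omega>" and C: "compact C" "C \<subseteq> \<Omega>"
    and f: "integrable lborel f" "\<And>y. y \<notin> C \<Longrightarrow> f y = 0"
  obtains G L where "G \<in> borel_measurable borel" "\<And>z. \<bar>G z\<bar> \<le> L" "\<And>z. z \<notin> \<Omega> - C \<Longrightarrow> G z = 0"
    "\<And>h. harmonic_on \<Omega> h \<Longrightarrow> bounded (h ` \<Omega>) \<Longrightarrow>
       (\<integral>z. h z * G z \<partial>lborel) = (\<integral>y. h y * f y \<partial>lborel)"
proof -
  obtain \<epsilon> where \<epsilon>: "0 < \<epsilon>" "(\<Union>x\<in>C. ball x \<epsilon>) \<subseteq> \<Omega>"
    using compact_subset_open_imp_ball_epsilon_subset[OF C(1) \<Omega>(1) C(2)] .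
  define r where "r = \<epsilon> / 2 / (3 * real DIM('a))"
  have r: "0 < r" "real DIM('a) * (3 * r) = \<epsilon> / 2" using \<epsilon>(1) by (auto simp: r_def)
  define A where "A = (\<Union>x\<in>C. ball x (\<epsilon> / 2))"
  have CA: "C \<subseteq> A" using \<epsilon>(1) by (auto simp: A_def)
  have A\<Omega>: "cball y (\<epsilon> / 2) \<subseteq> \<Omega>" if "y \<in> A" for y
  proof
    fix z assume z: "z \<in> cball y (\<epsilon> / 2)"
    from that obtain x where "x \<in> C" "dist x y < \<epsilon> / 2" by (auto simp: A_def)
    then have "z \<in> ball x \<epsilon>" using z dist_triangle[of x z y] by auto
    then show "z \<in> \<Omega>" using \<epsilon>(2) \<open>x \<in> C\<close> by blast
  qed
  have "1 * (1 * r) \<le> real DIM('a) * (3 * r)"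
    using r(1) DIM_ge_Suc0[where 'a='a] by (intro mult_mono) auto
  then have r_le: "r \<le> \<epsilon> / 2" unfolding r(2) by simp
  have reach: "z \<in> \<Omega>" if "y \<in> A" "cap_kernel r y z \<noteq> 0" for y z
  proof -
    have "dist y z < r" using cap_kernel_eq_0[of r y z] that(2) r(1) by linarith
    then have "z \<in> cball y (\<epsilon> / 2)" using r_le by simp
    then show ?thesis using A\<Omega>[OF that(1)] by blast
  qed
  interpret bounded_markov_kernel lborel "cap_kernel r :: 'a \<Rightarrow> 'a \<Rightarrow> real"
    "r\<^sup>2 / (\<integral>u. paraboloid_cap r (u::'a) \<partial>lborel)"
    by (rule bounded_markov_kernel_cap_kernel[OF r(1)])
  have A: "A \<in> sets lborel" by (auto simp: A_def intro: borel_open)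
  have [measurable]: "\<Omega> \<in> sets borel" using \<Omega>(1) by (rule borel_open)
  define c where "c = (\<integral>u. cap_kernel r 0 u * ((u::'a) \<bullet> u) \<partial>lborel)"
  have mean: "has_bochner_integral lborel (\<lambda>z. cap_kernel r y z * h z) (h y)"
    if "harmonic_on \<Omega> h" "h \<in> borel_measurable borel" "y \<in> A" for h y
    using harmonic_cap_mean[OF r(1) that(2), of y] harmonic_on_subset[OF that(1) A\<Omega>[OF that(3)]]
    by (simp add: r(2))
  have second_moment: "has_bochner_integral lborel (\<lambda>z. cap_kernel r y z * ((z - y) \<bullet> (z - y))) c"
    for y :: 'a
  proof -
    have "integrable lborel (\<lambda>u::'a. paraboloid_cap r u * (u \<bullet> u) / (\<integral>u. paraboloid_cap r (u::'a) \<partial>lborel))"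
      by (intro integrable_divide_zero impI integrable_paraboloid_cap_mult r continuous_intros)
    then have "has_bochner_integral lborel (\<lambda>u::'a. cap_kernel r 0 u * (u \<bullet> u)) c"
      by (simp add: has_bochner_integral_iff c_def cap_kernel_def)
    then have "has_bochner_integral lborel (\<lambda>u. cap_kernel r y (y + u) * (((y + u) - y) \<bullet> ((y + u) - y))) c"
      by (simp add: cap_kernel_def)
    moreover have "(\<lambda>z. cap_kernel r y z * ((z - y) \<bullet> (z - y))) \<in> borel_measurable borel"
      unfolding cap_kernel_def by measurable
    ultimately show ?thesis
      using lborel_has_bochner_integral_translate[of "\<lambda>z. cap_kernel r y z * ((z - y) \<bullet> (z - y))" y c]
      by simp
  qed
  have "c \<noteq> 0"
  proof
    assume "c = 0"
    have "integrable lborel (\<lambda>u::'a. cap_kernel r 0 u * (u \<bullet> u))"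
      using second_moment[of 0] by (simp add: has_bochner_integral_iff)
    then have "AE u::'a in lborel. cap_kernel r 0 u * (u \<bullet> u) = 0"
      by (rule integral_nonneg_eq_0_iff_AE[THEN iffD1])
         (use \<open>c = 0\<close> kernel_nonneg in \<open>auto simp: c_def\<close>)
    with AE_lborel_singleton[of "0::'a"] have "AE u::'a in lborel. cap_kernel r 0 u = 0"
      by eventually_elim simp
    then have "(\<integral>u. cap_kernel r (0::'a) u \<partial>lborel) = 0"
      by (rule integral_eq_zero_AE)
    moreover have "(\<integral>u. cap_kernel r (0::'a) u \<partial>lborel) = 1"
      using kernel_mass[of 0] by (simp add: has_bochner_integral_iff)
    ultimately show False by simp
  qed
  moreover have "0 \<le> c" unfolding c_def
    by (intro Bochner_Integration.integral_nonneg mult_nonneg_nonneg kernel_nonneg) auto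
  ultimately have c: "0 < c" by simp
  obtain R where R: "\<And>z. z \<in> \<Omega> \<Longrightarrow> norm z \<le> R" using \<Omega>(2) by (auto simp: bounded_iff)
  \<comment> \<open>The indicator keeps \<open>w\<close> bounded; the walk never sees a point outside \<open>\<Omega>\<close>.\<close>
  define w where "w z = indicator \<Omega> z * (R\<^sup>2 - z \<bullet> z)" for z
  have w: "w \<in> borel_measurable lborel" unfolding w_def by measurable
  have w_bounds: "0 \<le> w z" "w z \<le> R\<^sup>2" for z
    using R[of z] power_mono[of "norm z" R 2]
    by (auto simp: w_def indicator_def power2_norm_eq_inner[symmetric])
  have drift: "(\<integral>z. cap_kernel r y z * w z \<partial>lborel) \<le> w y - c" if y: "y \<in> A" for y
  proof -
    have "y \<in> \<Omega>" using A\<Omega>[OF y] \<epsilon>(1) by auto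
    \<comment> \<open>Write \<open>z \<bullet> z\<close> as \<open>(z - y) \<bullet> (z - y) + 2 * (z \<bullet> y) - y \<bullet> y\<close>. The linear term is harmonic, so its
      mean is its value at \<open>y\<close>.\<close>
    have "has_bochner_integral lborel (\<lambda>z. cap_kernel r y z * (R\<^sup>2 + y \<bullet> y) -
        cap_kernel r y z * ((z - y) \<bullet> (z - y)) - 2 * (cap_kernel r y z * (z \<bullet> y)))
        (R\<^sup>2 + y \<bullet> y - c - 2 * (y \<bullet> y))"
      by (intro has_bochner_integral_diff has_bochner_integral_mult_right second_moment
          mean[OF harmonic_on_inner_left _ y] mean[OF harmonic_on_const _ y]) measurable
    also have "(\<lambda>z. cap_kernel r y z * (R\<^sup>2 + y \<bullet> y) -
        cap_kernel r y z * ((z - y) \<bullet> (z - y)) - 2 * (cap_kernel r y z * (z \<bullet> y))) =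
        (\<lambda>z. cap_kernel r y z * w z)"
    proof
      fix z
      show "cap_kernel r y z * (R\<^sup>2 + y \<bullet> y) -
        cap_kernel r y z * ((z - y) \<bullet> (z - y)) - 2 * (cap_kernel r y z * (z \<bullet> y)) =
        cap_kernel r y z * w z"
        using reach[OF y, of z]
        by (cases "cap_kernel r y z = 0")
           (auto simp: w_def inner_diff inner_commute algebra_simps)
    qed
    finally show ?thesis
      using \<open>y \<in> \<Omega>\<close> by (simp add: has_bochner_integral_iff w_def)
  qed
  have fA: "f y = 0" if "y \<notin> A" for y using f(2) CA that by auto
  obtain G L where G: "G \<in> borel_measurable lborel" "\<And>z. z \<in> space lborel \<Longrightarrow> \<bar>G z\<bar> \<le> L"
    "\<And>z. z \<in> A \<Longrightarrow> G z = 0" "\<And>z. G z \<noteq> 0 \<Longrightarrow> \<exists>y\<in>A. cap_kernel r y z \<noteq> 0"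
    and dual: "\<And>h H. h \<in> borel_measurable lborel \<Longrightarrow> (\<And>z. z \<in> space lborel \<Longrightarrow> \<bar>h z\<bar> \<le> H) \<Longrightarrow>
       (\<And>y. y \<in> A \<Longrightarrow> (\<integral>z. cap_kernel r y z * h z \<partial>lborel) = h y) \<Longrightarrow>
       (\<integral>z. h z * G z \<partial>lborel) = (\<integral>y. h y * f y \<partial>lborel)"
    using sweeping[OF A w w_bounds c drift f(1) fA] by blast
  have G0: "G z = 0" if "z \<notin> \<Omega> - C" for z
    using G(3,4)[of z] reach that CA by blast
  show thesis
  proof (rule that[of G L])
    fix h assume h: "harmonic_on \<Omega> h" and b: "bounded (h ` \<Omega>)"
    obtain H where H: "\<And>z. z \<in> \<Omega> \<Longrightarrow> \<bar>h z\<bar> \<le> H" using b by (auto simp: bounded_iff)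
    \<comment> \<open>Nothing is known about \<open>h\<close> outside \<open>\<Omega>\<close>, where it need not be bounded or measurable.\<close>
    define h' where "h' z = indicator \<Omega> z * h z" for z
    have h'_measurable: "h' \<in> borel_measurable borel"
      using borel_measurable_continuous_on_indicator[OF _ harmonic_on_imp_continuous_on[OF h]] \<Omega>
      by (simp add: h'_def[abs_def])
    have "harmonic_on \<Omega> h'"
      by (rule harmonic_on_cong[OF h \<Omega>(1)]) (simp add: h'_def)
    have "(\<integral>z. h' z * G z \<partial>lborel) = (\<integral>y. h' y * f y \<partial>lborel)"
    proof (rule dual)
      show "h' \<in> borel_measurable lborel" using h'_measurable by simp
      show "\<bar>h' z\<bar> \<le> \<bar>H\<bar>" for z using H[of z] by (auto simp: h'_def indicator_def)
      show "(\<integral>z. cap_kernel r y z * h' z \<partial>lborel) = h' y" if "y \<in> A" for y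
        using mean[OF \<open>harmonic_on \<Omega> h'\<close> h'_measurable that] by (simp add: has_bochner_integral_iff)
    qed
    moreover have "h' z * G z = h z * G z" "h' z * f z = h z * f z" for z
      using G0[of z] f(2)[of z] C(2) by (cases "z \<in> \<Omega>"; auto simp: h'_def)+
    ultimately show "(\<integral>z. h z * G z \<partial>lborel) = (\<integral>y. h y * f y \<partial>lborel)" by simp
  qed (use G G0 in auto)
qed

section \<open>Harmonicity of the field of the Newton kernel\<close>

lemma has_derivative_norm_powr:
  fixes x y :: "'a::real_inner"
  assumes "y \<noteq> x"
  shows "((\<lambda>y. norm (y - x) powr s) has_derivative
    (\<lambda>v. s * norm (y - x) powr (s - 2) * ((y - x) \<bullet> v))) (at y)"
proof -
  let ?z = "y - x"
  have z: "0 < norm ?z" using assms by simp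
  have "GDERIV (\<lambda>z. norm z powr s) ?z :> (s * norm ?z powr (s - 1)) *\<^sub>R sgn ?z"
    by (rule GDERIV_DERIV_compose[OF GDERIV_norm has_real_derivative_powr[OF z]]) (use assms in simp)
  moreover have "norm ?z powr (s - 1) / norm ?z = norm ?z powr (s - 2)"
    using z powr_diff[of "norm ?z" "s - 1" 1] by simp
  ultimately have "GDERIV (\<lambda>z. norm z powr s) ?z :> (s * norm ?z powr (s - 2)) *\<^sub>R ?z"
    by (simp add: sgn_div_norm divide_inverse mult.assoc)
  then have "((\<lambda>z. norm z powr s) has_derivative (\<lambda>v. s * norm ?z powr (s - 2) * (?z \<bullet> v))) (at ?z)"
    by (simp add: gderiv_def inner_commute mult.assoc)
  moreover have "((\<lambda>y. y - x) has_derivative (\<lambda>v. v)) (at y)"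
    by (auto intro!: derivative_eq_intros)
  ultimately show ?thesis
    using has_derivative_compose by blast
qed

lemma harmonic_on_mult_left:
  assumes "harmonic_on S h" shows "harmonic_on S (\<lambda>y. c * h y)"
  using assms
proof (rule harmonic_onE)
  fix G DG
  assume *: "\<And>x. x \<in> S \<Longrightarrow> (h has_derivative (\<lambda>v. v \<bullet> G x)) (at x)"
    "\<And>x. x \<in> S \<Longrightarrow> (G has_derivative DG x) (at x)"
    "\<And>b. b \<in> Basis \<Longrightarrow> continuous_on S (\<lambda>x. DG x b \<bullet> b)"
    "\<And>x. x \<in> S \<Longrightarrow> (\<Sum>b\<in>Basis. DG x b \<bullet> b) = 0"
  show ?thesis
  proof (rule harmonic_onI[where G="\<lambda>x. c *\<^sub>R G x" and DG="\<lambda>x v. c *\<^sub>R DG x v"])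
    fix x assume x: "x \<in> S"
    show "((\<lambda>y. c * h y) has_derivative (\<lambda>v. v \<bullet> c *\<^sub>R G x)) (at x)"
      using has_derivative_mult_right[OF *(1)[OF x], of c] by simp
    show "((\<lambda>x. c *\<^sub>R G x) has_derivative (\<lambda>v. c *\<^sub>R DG x v)) (at x)"
      by (rule has_derivative_scaleR_right[OF *(2)[OF x]])
    show "(\<Sum>b\<in>Basis. (c *\<^sub>R DG x b) \<bullet> b) = 0"
      using *(4)[OF x] by (simp flip: sum_distrib_left)
  next
    fix b :: 'a assume "b \<in> Basis"
    then show "continuous_on S (\<lambda>x. (c *\<^sub>R DG x b) \<bullet> b)"
      unfolding inner_scaleR_left by (intro continuous_intros *(3))
  qed
qed

text \<open>Up to a constant this is the derivative in direction \<open>a\<close> of the fundamental solution with pole \<open>x\<close>.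
With \<open>z = y - x\<close> and \<open>d\<close> the dimension, the trace of the Hessian \<open>DG y\<close> is \<open>z \<bullet> a\<close> times
\<open>norm z powr (- d - 2)\<close> times \<open>- d * (d + 2) + d * (d + 2)\<close>.\<close>

lemma harmonic_on_dipole:
  fixes x a :: "'a::euclidean_space"
  assumes x: "x \<notin> S"
  shows "harmonic_on S (\<lambda>y. norm (y - x) powr (- real DIM('a)) * ((y - x) \<bullet> a))"
proof -
  let ?d = "real DIM('a)"
  define p where "p s y = norm (y - x) powr s" for s y
  define G where "G y = p (- ?d) y *\<^sub>R a - (?d * p (- ?d - 2) y * ((y - x) \<bullet> a)) *\<^sub>R (y - x)" for y
  define DG where "DG y v =
    (- ?d * p (- ?d - 2) y * ((y - x) \<bullet> v)) *\<^sub>R a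
    - (?d * p (- ?d - 2) y * ((y - x) \<bullet> a)) *\<^sub>R v
    - (?d * p (- ?d - 2) y * (v \<bullet> a)
       - ?d * (?d + 2) * p (- ?d - 4) y * ((y - x) \<bullet> v) * ((y - x) \<bullet> a)) *\<^sub>R (y - x)" for y v
  have p': "(p s has_derivative (\<lambda>v. s * p (s - 2) y * ((y - x) \<bullet> v))) (at y)" if "y \<in> S" for s y
    unfolding p_def by (rule has_derivative_norm_powr) (use that x in auto)
  have contp: "continuous_on S (p s)" for s
    unfolding p_def by (intro continuous_intros) (use x in auto)
  show ?thesis
    unfolding p_def[symmetric]
  proof (rule harmonic_onI[where G=G and DG=DG])
    fix y assume y: "y \<in> S"
    have id': "((\<lambda>y. y - x) has_derivative (\<lambda>v. v)) (at y)"
      by (auto intro!: derivative_eq_intros)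
    have ia': "((\<lambda>y. (y - x) \<bullet> a) has_derivative (\<lambda>v. v \<bullet> a)) (at y)"
      by (rule has_derivative_inner_left[OF id'])
    have "((\<lambda>y. p (- ?d) y * ((y - x) \<bullet> a)) has_derivative (\<lambda>v. p (- ?d) y * (v \<bullet> a) +
        - ?d * p (- ?d - 2) y * ((y - x) \<bullet> v) * ((y - x) \<bullet> a))) (at y)"
      by (rule has_derivative_mult[OF p'[OF y] ia'])
    also have "(\<lambda>v. p (- ?d) y * (v \<bullet> a) +
        - ?d * p (- ?d - 2) y * ((y - x) \<bullet> v) * ((y - x) \<bullet> a)) = (\<lambda>v. v \<bullet> G y)"
      by (simp add: fun_eq_iff G_def inner_diff_right inner_commute[of "y - x" v for v])
    finally show "((\<lambda>y. p (- ?d) y * ((y - x) \<bullet> a)) has_derivative (\<lambda>v. v \<bullet> G y)) (at y)" .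
    have "(G has_derivative (\<lambda>v. (- ?d * p (- ?d - 2) y * ((y - x) \<bullet> v)) *\<^sub>R a -
        ((?d * p (- ?d - 2) y * ((y - x) \<bullet> a)) *\<^sub>R v +
         (?d * p (- ?d - 2) y * (v \<bullet> a) +
          ?d * ((- ?d - 2) * p (- ?d - 2 - 2) y * ((y - x) \<bullet> v)) * ((y - x) \<bullet> a)) *\<^sub>R (y - x))))
        (at y)"
      unfolding G_def[abs_def]
      by (intro has_derivative_diff has_derivative_scaleR_left has_derivative_scaleR
          has_derivative_mult has_derivative_mult_right p'[OF y] ia' id')
    also have "(\<lambda>v. (- ?d * p (- ?d - 2) y * ((y - x) \<bullet> v)) *\<^sub>R a -
        ((?d * p (- ?d - 2) y * ((y - x) \<bullet> a)) *\<^sub>R v +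
         (?d * p (- ?d - 2) y * (v \<bullet> a) +
          ?d * ((- ?d - 2) * p (- ?d - 2 - 2) y * ((y - x) \<bullet> v)) * ((y - x) \<bullet> a)) *\<^sub>R (y - x))) =
        DG y"
    proof
      have "- ?d - 2 - 2 = - ?d - 4" by simp
      then have "?d * p (- ?d - 2) y * (v \<bullet> a) +
          ?d * ((- ?d - 2) * p (- ?d - 2 - 2) y * ((y - x) \<bullet> v)) * ((y - x) \<bullet> a) =
          ?d * p (- ?d - 2) y * (v \<bullet> a) -
          ?d * (?d + 2) * p (- ?d - 4) y * ((y - x) \<bullet> v) * ((y - x) \<bullet> a)" for v
        by (simp add: algebra_simps)
      then show "(- ?d * p (- ?d - 2) y * ((y - x) \<bullet> v)) *\<^sub>R a -
        ((?d * p (- ?d - 2) y * ((y - x) \<bullet> a)) *\<^sub>R v +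
         (?d * p (- ?d - 2) y * (v \<bullet> a) +
          ?d * ((- ?d - 2) * p (- ?d - 2 - 2) y * ((y - x) \<bullet> v)) * ((y - x) \<bullet> a)) *\<^sub>R (y - x)) =
        DG y v" for v
        by (simp only: DG_def diff_diff_add)
    qed
    finally show "(G has_derivative DG y) (at y)" .
    have q: "p (- ?d - 4) y * ((y - x) \<bullet> (y - x)) = p (- ?d - 2) y"
    proof -
      have exponent: "- ?d - 4 + 2 = - ?d - 2" by simp
      have "0 < norm (y - x)" using y x by auto
      then have "p (- ?d - 4) y * norm (y - x) powr 2 = p (- ?d - 2) y"
        unfolding p_def powr_add[symmetric] exponent by simp
      then show ?thesis using \<open>0 < norm (y - x)\<close> by (simp add: power2_norm_eq_inner)
    qed
    have tr: "(\<Sum>b\<in>Basis. (u \<bullet> b) * (v \<bullet> b)) = u \<bullet> v" for u v :: 'a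
      by (rule euclidean_inner[symmetric])
    have "(\<Sum>b\<in>Basis. DG y b \<bullet> b) =
      - ?d * p (- ?d - 2) y * (\<Sum>b\<in>Basis. ((y - x) \<bullet> b) * (a \<bullet> b))
      - ?d * p (- ?d - 2) y * ((y - x) \<bullet> a) * (\<Sum>b\<in>(Basis::'a set). 1)
      - ?d * p (- ?d - 2) y * (\<Sum>b\<in>Basis. (a \<bullet> b) * ((y - x) \<bullet> b))
      + ?d * (?d + 2) * p (- ?d - 4) y * ((y - x) \<bullet> a) * (\<Sum>b\<in>Basis. ((y - x) \<bullet> b) * ((y - x) \<bullet> b))"
      unfolding sum_distrib_left sum_subtractf[symmetric] sum.distrib[symmetric]
      by (rule sum.cong) (auto simp: DG_def inner_diff_left inner_commute[of _ a] algebra_simps)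
    also have "\<dots> = - ?d * p (- ?d - 2) y * ((y - x) \<bullet> a) * (?d + 2)
      + ?d * (?d + 2) * ((y - x) \<bullet> a) * (p (- ?d - 4) y * ((y - x) \<bullet> (y - x)))"
      unfolding tr by (simp add: inner_commute[of a] algebra_simps)
    also have "\<dots> = 0" unfolding q by simp
    finally show "(\<Sum>b\<in>Basis. DG y b \<bullet> b) = 0" .
  next
    fix b :: 'a
    show "continuous_on S (\<lambda>y. DG y b \<bullet> b)"
      unfolding DG_def by (intro continuous_intros contp)
  qed
qed

text \<open>The gradient of the Newton kernel away from the origin, extended to a Borel function on the whole
space.\<close>

definition newton_field :: "real^'n \<Rightarrow> real^'n" where
  "newton_field u = (1 / ((real CARD('n) - 2) * unit_sphere_area TYPE('n)) * (2 - real CARD('n)) *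
     norm u powr (- real CARD('n))) *\<^sub>R u"

lemma gradient_newton_kernel:
  fixes u :: "real^'n"
  assumes "u \<noteq> 0"
  shows "gradient newton_kernel u = newton_field u"
proof -
  let ?c = "1 / ((real CARD('n) - 2) * unit_sphere_area TYPE('n))"
  have "((\<lambda>u. ?c * norm (u - 0) powr (2 - real CARD('n))) has_derivative
      (\<lambda>v. ?c * ((2 - real CARD('n)) * norm (u - 0) powr (2 - real CARD('n) - 2) * ((u - 0) \<bullet> v)))) (at u)"
    by (intro has_derivative_mult_right has_derivative_norm_powr assms)
  then have *: "GDERIV newton_kernel u :> newton_field u"
    by (simp add: gderiv_def newton_kernel_def[abs_def] newton_field_def inner_commute mult.assoc)
  moreover have "D = newton_field u" if "GDERIV newton_kernel u :> D" for D
    using has_derivative_unique[OF that[unfolded gderiv_def] *[unfolded gderiv_def]]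
    by (metis vector_eq_rdot inner_commute)
  ultimately show ?thesis
    unfolding gradient_def by (rule the_equality)
qed

lemma harmonic_on_newton_field:
  fixes x :: "real^'n"
  assumes "x \<notin> S"
  shows "harmonic_on S (\<lambda>y. newton_field (x - y) $ i)"
proof -
  have eq: "(\<lambda>y. newton_field (x - y) $ i) = (\<lambda>y.
    (1 / ((real CARD('n) - 2) * unit_sphere_area TYPE('n)) * (real CARD('n) - 2)) *
    (norm (y - x) powr (- real DIM(real^'n)) * ((y - x) \<bullet> axis i 1)))"
  proof
    fix y
    have "c * (2 - d) * N * (u - v) = c * (d - 2) * (N * (v - u))" for c d N u v :: real
      by algebra
    then show "newton_field (x - y) $ i =
      (1 / ((real CARD('n) - 2) * unit_sphere_area TYPE('n)) * (real CARD('n) - 2)) *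
      (norm (y - x) powr (- real DIM(real^'n)) * ((y - x) \<bullet> axis i 1))"
      by (simp only: newton_field_def inner_axis norm_minus_commute[of x y] vector_scaleR_component
          vector_minus_component DIM_cart DIM_real mult_1_right inner_real_def real_scaleR_def)
  qed
  show ?thesis unfolding eq by (intro harmonic_on_mult_left harmonic_on_dipole assms)
qed

lemma bounded_newton_field:
  fixes x :: "real^'n"
  assumes "bounded S" "x \<notin> closure S"
  obtains M where "\<And>y. y \<in> S \<Longrightarrow> norm (newton_field (x - y)) \<le> M"
proof -
  have "compact (closure S)" using assms(1) by (simp add: compact_closure)
  moreover have "continuous_on (closure S) (\<lambda>y. newton_field (x - y))"
    unfolding newton_field_def by (intro continuous_intros) (use assms(2) in auto)
  ultimately have "bounded ((\<lambda>y. newton_field (x - y)) ` closure S)"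
    by (intro compact_imp_bounded compact_continuous_image)
  then show thesis
    using that closure_subset[of S] by (force simp: bounded_iff)
qed

lemma borel_measurable_newton_field [measurable]: "newton_field \<in> borel_measurable borel"
  unfolding newton_field_def[abs_def] by measurable

lemma magnetic_potential_eq:
  assumes "U \<in> sets lebesgue" "x \<notin> U"
  shows "magnetic_potential U h x =
    (\<integral>y. newton_field (x - y) \<bullet> (indicator U y *\<^sub>R h y) \<partial>lebesgue)"
proof -
  have "magnetic_potential U h x = (\<integral>y. newton_field (x - y) \<bullet> h y \<partial>lebesgue_on U)"
    unfolding magnetic_potential_def
    by (rule Bochner_Integration.integral_cong)
       (use assms in \<open>auto intro!: arg_cong2[where f=inner] gradient_newton_kernel\<close>)
  then show ?thesis using assms(1) by (simp add: integral_restrict_space)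
qed



section \<open>Square integrable fields and their magnetic potentials\<close>

lemma integrable_if_L2_field:
  assumes "bounded U" "U \<in> sets lebesgue" and f: "L2_field U f"
  shows "integrable lebesgue (\<lambda>y. indicator U y *\<^sub>R f y)"
proof -
  have "U \<in> lmeasurable" using assms(1,2) by (rule bounded_set_imp_lmeasurable)
  then interpret finite_measure "lebesgue_on U" by (rule finite_measure_lebesgue_on)
  have "t \<le> 1 + t\<^sup>2" for t :: real
    using sum_power2_ge_zero[of "t - 1 / 2" 0] by (simp add: power2_eq_square algebra_simps)
  then have "integrable (lebesgue_on U) f"
    using f unfolding L2_field_def
    by (intro Bochner_Integration.integrable_bound[where f="\<lambda>y. 1 + (norm (f y))\<^sup>2" and g=f]) auto
  then show ?thesis using assms(2) by (simp add: integrable_restrict_space)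
qed

lemma L2_field_add_bounded:
  assumes U: "bounded U" "U \<in> sets lebesgue" and V: "V \<in> sets lebesgue" "V \<subseteq> U"
    and f: "L2_field U f"
    and g: "g \<in> borel_measurable borel" "\<And>y. norm (g y) \<le> L"
  shows "L2_field V (\<lambda>y. f y + g y)"
proof -
  have fV: "f \<in> borel_measurable (lebesgue_on V)"
    using f V(2) unfolding L2_field_def by (auto intro: measurable_restrict_mono)
  have gV: "g \<in> borel_measurable (lebesgue_on V)"
    using g(1) by (intro measurable_restrict_space1 measurable_completion) simp
  have sum_meas: "(\<lambda>y. f y + g y) \<in> borel_measurable (lebesgue_on V)"
    using fV gV by (rule borel_measurable_add)
  have "V \<in> lmeasurable" using bounded_subset[OF U(1) V(2)] V(1) by (rule bounded_set_imp_lmeasurable)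
  then interpret finite_measure "lebesgue_on V" by (rule finite_measure_lebesgue_on)
  have "integrable (lebesgue_on U) (\<lambda>y. (norm (f y))\<^sup>2)" using f by (simp add: L2_field_def)
  then have "integrable lebesgue (\<lambda>y. indicator U y *\<^sub>R (norm (f y))\<^sup>2)"
    using U(2) by (simp add: integrable_restrict_space)
  then have "integrable lebesgue (\<lambda>y. indicator V y *\<^sub>R (indicator U y *\<^sub>R (norm (f y))\<^sup>2))"
    by (rule integrable_mult_indicator[OF V(1)])
  also have "(\<lambda>y. indicator V y *\<^sub>R (indicator U y *\<^sub>R (norm (f y))\<^sup>2)) =
      (\<lambda>y. indicator V y *\<^sub>R (norm (f y))\<^sup>2)"
    using V(2) by (auto simp: fun_eq_iff indicator_def)
  finally have "integrable (lebesgue_on V) (\<lambda>y. (norm (f y))\<^sup>2)"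
    using V(1) by (simp add: integrable_restrict_space)
  then have "integrable (lebesgue_on V) (\<lambda>y. 2 * (norm (f y))\<^sup>2 + 2 * L\<^sup>2)" by simp
  then have "integrable (lebesgue_on V) (\<lambda>y. (norm (f y + g y))\<^sup>2)"
  proof (rule Bochner_Integration.integrable_bound)
    have "(norm (f y + g y))\<^sup>2 \<le> 2 * (norm (f y))\<^sup>2 + 2 * L\<^sup>2" for y
    proof -
      have "norm (f y + g y) \<le> norm (f y) + L"
        using norm_triangle_ineq[of "f y" "g y"] g(2)[of y] by linarith
      then have "(norm (f y + g y))\<^sup>2 \<le> (norm (f y) + L)\<^sup>2" by (intro power_mono) auto
      also have "\<dots> \<le> 2 * (norm (f y))\<^sup>2 + 2 * L\<^sup>2"
        using zero_le_power2[of "norm (f y) - L"] by (simp add: power2_eq_square algebra_simps)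
      finally show ?thesis .
    qed
    then show "AE y in lebesgue_on V. norm ((norm (f y + g y))\<^sup>2) \<le> norm (2 * (norm (f y))\<^sup>2 + 2 * L\<^sup>2)"
      by (auto intro!: AE_I2)
  qed (use sum_meas in measurable)
  then show ?thesis using sum_meas by (simp add: L2_field_def)
qed

text \<open>Balayage of every component of a field. It is carried out on Borel representatives \<open>\<Phi> i\<close> of the
Lebesgue measurable components, cut off outside \<open>C\<close>.\<close>

lemma vector_field_balayage:
  fixes \<Omega> C :: "(real^'n) set" and F :: "real^'n \<Rightarrow> real^'n"
  assumes \<Omega>: "open \<Omega>" "bounded \<Omega>" and C: "compact C" "C \<subseteq> \<Omega>"
    and F: "integrable lebesgue F" "\<And>y. y \<notin> C \<Longrightarrow> F y = 0"
  obtains G L where "G \<in> borel_measurable borel" "\<And>z. norm (G z) \<le> L"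
    "\<And>z. z \<notin> \<Omega> - C \<Longrightarrow> G z = 0"
    "\<And>V M. V \<in> borel_measurable borel \<Longrightarrow> (\<And>i. harmonic_on \<Omega> (\<lambda>y. V y $ i)) \<Longrightarrow>
       (\<And>y. y \<in> \<Omega> \<Longrightarrow> norm (V y) \<le> M) \<Longrightarrow>
       integrable lebesgue (\<lambda>y. V y \<bullet> G y) \<and>
       (\<integral>y. V y \<bullet> F y \<partial>lebesgue) = (\<integral>y. V y \<bullet> G y \<partial>lebesgue)"
proof -
  have [measurable]: "C \<in> sets borel" "\<Omega> \<in> sets borel"
    using C(1) \<Omega>(1) by (auto intro: borel_compact borel_open)
  have Fi: "integrable lebesgue (\<lambda>y. F y $ i)" for i
    using integrable_inner_left[OF F(1), of "axis i 1"] by (simp add: inner_axis)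
  have "\<exists>\<Phi>. \<Phi> \<in> borel_measurable borel \<and> (AE y in lborel. F y $ i = \<Phi> y)" for i
    using completion_ex_borel_measurable_real[OF borel_measurable_integrable[OF Fi[of i]]] by auto
  then obtain \<Phi>0 where \<Phi>0: "\<And>i. \<Phi>0 i \<in> borel_measurable borel"
    "\<And>i. AE y in lborel. F y $ i = \<Phi>0 i y" by metis
  define \<Phi> where "\<Phi> i y = indicator C y * \<Phi>0 i y" for i y
  have \<Phi>_meas [measurable]: "\<Phi> i \<in> borel_measurable borel" for i
    using \<Phi>0(1)[of i] unfolding \<Phi>_def[abs_def] by measurable
  have \<Phi>_AE: "AE y in lebesgue. F y $ i = \<Phi> i y" for i
    using AE_completion[OF \<Phi>0(2)[of i]]
  proof eventually_elim
    case (elim y) then show ?case using F(2)[of y] by (cases "y \<in> C") (auto simp: \<Phi>_def)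
  qed
  have \<Phi>_int: "integrable lborel (\<Phi> i)" for i
  proof -
    have "integrable lebesgue (\<Phi> i)"
      by (rule integrable_cong_AE_imp[OF Fi[of i] _ \<Phi>_AE]) (simp add: measurable_completion)
    then show ?thesis using integrable_completion[of "\<Phi> i" lborel] by simp
  qed
  have "\<forall>i. \<exists>G L. G \<in> borel_measurable borel \<and> (\<forall>z. \<bar>G z\<bar> \<le> L) \<and> (\<forall>z. z \<notin> \<Omega> - C \<longrightarrow> G z = 0) \<and>
      (\<forall>h. harmonic_on \<Omega> h \<longrightarrow> bounded (h ` \<Omega>) \<longrightarrow>
         (\<integral>z. h z * G z \<partial>lborel) = (\<integral>y. h y * \<Phi> i y \<partial>lborel))"
  proof (intro allI, rule harmonic_balayage[OF \<Omega> C \<Phi>_int])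
    fix i G L
    assume "G \<in> borel_measurable borel" "\<And>z. \<bar>G z\<bar> \<le> L" "\<And>z. z \<notin> \<Omega> - C \<Longrightarrow> G z = 0"
      "\<And>h. harmonic_on \<Omega> h \<Longrightarrow> bounded (h ` \<Omega>) \<Longrightarrow>
         (\<integral>z. h z * G z \<partial>lborel) = (\<integral>y. h y * \<Phi> i y \<partial>lborel)"
    then show "\<exists>G L. G \<in> borel_measurable borel \<and> (\<forall>z. \<bar>G z\<bar> \<le> L) \<and> (\<forall>z. z \<notin> \<Omega> - C \<longrightarrow> G z = 0) \<and>
      (\<forall>h. harmonic_on \<Omega> h \<longrightarrow> bounded (h ` \<Omega>) \<longrightarrow>
         (\<integral>z. h z * G z \<partial>lborel) = (\<integral>y. h y * \<Phi> i y \<partial>lborel))"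
      by (intro exI[of _ G] exI[of _ L]) simp
  qed (simp add: \<Phi>_def)
  from choice[OF this] obtain G where
    "\<forall>i. \<exists>L. G i \<in> borel_measurable borel \<and> (\<forall>z. \<bar>G i z\<bar> \<le> L) \<and> (\<forall>z. z \<notin> \<Omega> - C \<longrightarrow> G i z = 0) \<and>
      (\<forall>h. harmonic_on \<Omega> h \<longrightarrow> bounded (h ` \<Omega>) \<longrightarrow>
         (\<integral>z. h z * G i z \<partial>lborel) = (\<integral>y. h y * \<Phi> i y \<partial>lborel))" by blast
  from choice[OF this] obtain L where all:
    "\<And>i. G i \<in> borel_measurable borel \<and> (\<forall>z. \<bar>G i z\<bar> \<le> L i) \<and> (\<forall>z. z \<notin> \<Omega> - C \<longrightarrow> G i z = 0) \<and>
      (\<forall>h. harmonic_on \<Omega> h \<longrightarrow> bounded (h ` \<Omega>) \<longrightarrow>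
         (\<integral>z. h z * G i z \<partial>lborel) = (\<integral>y. h y * \<Phi> i y \<partial>lborel))" by blast
  then have G: "\<And>i. G i \<in> borel_measurable borel" "\<And>i z. \<bar>G i z\<bar> \<le> L i"
    "\<And>i z. z \<notin> \<Omega> - C \<Longrightarrow> G i z = 0"
    and dual: "\<And>i h. harmonic_on \<Omega> h \<Longrightarrow> bounded (h ` \<Omega>) \<Longrightarrow>
         (\<integral>z. h z * G i z \<partial>lborel) = (\<integral>y. h y * \<Phi> i y \<partial>lborel)" by blast+
  note [measurable] = G(1)
  show thesis
  proof (rule that[of "\<lambda>z. \<chi> i. G i z" "\<Sum>i\<in>UNIV. L i"])
    show "(\<lambda>z. \<chi> i. G i z) \<in> borel_measurable borel"
      by (subst borel_measurable_euclidean_space) (auto simp: Basis_vec_def inner_axis G(1))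
    show "norm (\<chi> i. G i z) \<le> (\<Sum>i\<in>UNIV. L i)" for z
      by (rule order_trans[OF norm_le_l1_cart]) (simp add: sum_mono G(2))
    show "(\<chi> i. G i z) = 0" if "z \<notin> \<Omega> - C" for z
      using G(3)[OF that] by (simp add: vec_eq_iff)
    fix V :: "real^'n \<Rightarrow> real^'n" and M
    assume V [measurable]: "V \<in> borel_measurable borel" and harm: "\<And>i. harmonic_on \<Omega> (\<lambda>y. V y $ i)"
      and M: "\<And>y. y \<in> \<Omega> \<Longrightarrow> norm (V y) \<le> M"
    have Vi [measurable]: "(\<lambda>y. V y $ i) \<in> borel_measurable borel" for i
      using borel_measurable_inner[OF V borel_measurable_const, of "axis i 1"] by (simp add: inner_axis)
    have VM: "\<bar>V y $ i\<bar> \<le> M" if "y \<in> \<Omega>" for y i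
      using component_le_norm_cart[of "V y" i] M[OF that] by linarith
    have intG: "integrable lborel (\<lambda>y. V y $ i * G i y)" for i
    proof (rule Bochner_Integration.integrable_bound[where f="\<lambda>y. indicator \<Omega> y * (M * L i)"])
      have "integrable lborel (indicator \<Omega> :: real^'n \<Rightarrow> real)"
        using emeasure_bounded_finite[OF \<Omega>(2)] by (simp add: integrable_indicator_iff)
      then show "integrable lborel (\<lambda>y. indicator \<Omega> y * (M * L i))" by simp
      have "\<bar>V y $ i * G i y\<bar> \<le> \<bar>indicator \<Omega> y * (M * L i)\<bar>" for y
      proof (cases "y \<in> \<Omega>")
        case True
        have "\<bar>V y $ i\<bar> * \<bar>G i y\<bar> \<le> M * L i"
          using VM[OF True, of i] G(2)[of i y] by (intro mult_mono) auto
        then show ?thesis using True by (simp add: abs_mult[symmetric])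
      qed (use G(3)[of y i] in auto)
      then show "AE y in lborel. norm (V y $ i * G i y) \<le> norm (indicator \<Omega> y * (M * L i))"
        by (auto intro!: AE_I2)
    qed measurable
    have intGleb: "integrable lebesgue (\<lambda>y. V y $ i * G i y)" for i
      using intG[of i] by (simp add: integrable_completion)
    have intF: "integrable lebesgue (\<lambda>y. V y $ i * F y $ i)" for i
    proof (rule Bochner_Integration.integrable_bound[where f="\<lambda>y. M * F y $ i"])
      show "integrable lebesgue (\<lambda>y. M * F y $ i)" using Fi by simp
      show "(\<lambda>y. V y $ i * F y $ i) \<in> borel_measurable lebesgue"
        using Vi[of i] Fi[of i]
        by (intro borel_measurable_times measurable_completion[of "\<lambda>y. V y $ i"]) auto
      have "\<bar>V y $ i * F y $ i\<bar> \<le> \<bar>M * F y $ i\<bar>" for y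
      proof (cases "y \<in> \<Omega>")
        case True
        then show ?thesis
          using VM[OF True, of i] by (auto simp: abs_mult intro!: mult_right_mono)
      next
        case False
        then have "F y = 0" using F(2)[of y] C(2) by blast
        then show ?thesis by simp
      qed
      then show "AE y in lebesgue. norm (V y $ i * F y $ i) \<le> norm (M * F y $ i)"
        by (auto intro!: AE_I2)
    qed
    have comp: "(\<integral>y. V y $ i * F y $ i \<partial>lebesgue) = (\<integral>y. V y $ i * G i y \<partial>lebesgue)" for i
    proof -
      have "bounded ((\<lambda>y. V y $ i) ` \<Omega>)" using VM by (auto simp: bounded_iff)
      have "(\<integral>y. V y $ i * F y $ i \<partial>lebesgue) = (\<integral>y. V y $ i * \<Phi> i y \<partial>lebesgue)"
      proof (rule Bochner_Integration.integral_cong_AE)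
        show "(\<lambda>y. V y $ i * F y $ i) \<in> borel_measurable lebesgue" using intF[of i] by auto
        show "(\<lambda>y. V y $ i * \<Phi> i y) \<in> borel_measurable lebesgue"
          by (intro measurable_completion) measurable
        show "AE y in lebesgue. V y $ i * F y $ i = V y $ i * \<Phi> i y"
          using \<Phi>_AE[of i] by eventually_elim simp
      qed
      also have "\<dots> = (\<integral>y. V y $ i * \<Phi> i y \<partial>lborel)"
        by (rule integral_completion) measurable
      also have "\<dots> = (\<integral>y. V y $ i * G i y \<partial>lborel)"
        by (rule dual[OF harm, symmetric]) fact
      also have "\<dots> = (\<integral>y. V y $ i * G i y \<partial>lebesgue)"
        by (rule integral_completion[symmetric]) measurable
      finally show ?thesis .
    qed
    show "integrable lebesgue (\<lambda>y. V y \<bullet> (\<chi> i. G i y)) \<and>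
       (\<integral>y. V y \<bullet> F y \<partial>lebesgue) = (\<integral>y. V y \<bullet> (\<chi> i. G i y) \<partial>lebesgue)"
      unfolding inner_vec_def inner_real_def vec_lambda_beta
      using intF intGleb comp by (simp add: Bochner_Integration.integral_sum)
  qed
qed

theorem corollary3p8:
  fixes \<Omega> \<Theta> :: "(real^'n) set"
  assumes "CARD('n) \<ge> 3"
    and "bounded \<Omega>" and "connected \<Omega>" and "simply_connected \<Omega>" and "lipschitz_domain \<Omega>"
    and "lipschitz_cluster \<Theta>"
    and "closure \<Theta> \<subseteq> \<Omega>"
  shows "\<forall>f. L2_field \<Omega> f \<longrightarrow>
    (\<exists>g. L2_field (\<Omega> - closure \<Theta>) g \<and>
      (\<forall>x \<in> - closure \<Omega>.
         magnetic_potential \<Omega> f x = magnetic_potential (\<Omega> - closure \<Theta>) g x))"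
proof (intro allI impI)
  fix f assume f: "L2_field \<Omega> f"
  let ?C = "closure \<Theta>"
  have "open \<Omega>" using assms(5) by (simp add: lipschitz_domain_def lipschitz_open_def)
  have "compact ?C"
    using bounded_subset[OF assms(2,7)] by (simp add: compact_eq_bounded_closed)
  have sets: "\<Omega> \<in> sets lebesgue" "?C \<in> sets lebesgue" "\<Omega> - ?C \<in> sets lebesgue"
    using \<open>open \<Omega>\<close> by auto
  \<comment> \<open>\<open>F\<close> is the part of the source on \<open>closure \<Theta>\<close>, to be swept away, and \<open>F'\<close> the part that is kept.\<close>
  define f\<Omega> where "f\<Omega> y = indicator \<Omega> y *\<^sub>R f y" for y
  have int\<Omega>: "integrable lebesgue f\<Omega>"
    unfolding f\<Omega>_def[abs_def] by (rule integrable_if_L2_field[OF assms(2) sets(1) f])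
  define F where "F y = indicator ?C y *\<^sub>R f\<Omega> y" for y
  have intF: "integrable lebesgue F"
    unfolding F_def[abs_def] by (rule integrable_mult_indicator[OF sets(2) int\<Omega>])
  define F' where "F' y = indicator (\<Omega> - ?C) y *\<^sub>R f y" for y
  have split: "f\<Omega> y = F y + F' y" for y
    using assms(7) by (auto simp: f\<Omega>_def F_def F'_def indicator_def)
  have intF': "integrable lebesgue F'"
  proof -
    have "F' = (\<lambda>y. f\<Omega> y - F y)" using split by (simp add: fun_eq_iff)
    then show ?thesis using int\<Omega> intF by simp
  qed
  obtain G L where G: "G \<in> borel_measurable borel" "\<And>z. norm (G z) \<le> L"
    "\<And>z. z \<notin> \<Omega> - ?C \<Longrightarrow> G z = 0"
    and dual: "\<And>V M. V \<in> borel_measurable borel \<Longrightarrow> (\<And>i. harmonic_on \<Omega> (\<lambda>y. V y $ i)) \<Longrightarrow>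
       (\<And>y. y \<in> \<Omega> \<Longrightarrow> norm (V y) \<le> M) \<Longrightarrow>
       integrable lebesgue (\<lambda>y. V y \<bullet> G y) \<and>
       (\<integral>y. V y \<bullet> F y \<partial>lebesgue) = (\<integral>y. V y \<bullet> G y \<partial>lebesgue)"
    by (rule vector_field_balayage[OF \<open>open \<Omega>\<close> assms(2) \<open>compact ?C\<close> assms(7) intF])
       (simp add: F_def, blast)
  show "\<exists>g. L2_field (\<Omega> - ?C) g \<and>
      (\<forall>x \<in> - closure \<Omega>. magnetic_potential \<Omega> f x = magnetic_potential (\<Omega> - ?C) g x)"
  proof (intro exI[of _ "\<lambda>y. f y + G y"] conjI ballI)
    show "L2_field (\<Omega> - ?C) (\<lambda>y. f y + G y)"
      by (rule L2_field_add_bounded[OF assms(2) sets(1,3) _ f G(1,2)]) auto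
    fix x assume x: "x \<in> - closure \<Omega>"
    then have x\<Omega>: "x \<notin> \<Omega>" "x \<notin> \<Omega> - ?C" using closure_subset[of \<Omega>] by auto
    let ?V = "\<lambda>y. newton_field (x - y)"
    have V: "?V \<in> borel_measurable borel" by measurable
    obtain M where M: "\<And>y. y \<in> \<Omega> \<Longrightarrow> norm (?V y) \<le> M"
      using bounded_newton_field[OF assms(2), of x] x by auto
    have intV: "integrable lebesgue (\<lambda>y. ?V y \<bullet> H y)"
      if "integrable lebesgue H" "\<And>y. y \<notin> \<Omega> \<Longrightarrow> H y = 0" for H
    proof (rule Bochner_Integration.integrable_bound[where f="\<lambda>y. M * norm (H y)"])
      show "integrable lebesgue (\<lambda>y. M * norm (H y))" using that(1) by simp
      show "(\<lambda>y. ?V y \<bullet> H y) \<in> borel_measurable lebesgue"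
        using that(1) V by (intro borel_measurable_inner measurable_completion[of ?V]) auto
      have "\<bar>?V y \<bullet> H y\<bar> \<le> \<bar>M * norm (H y)\<bar>" for y
      proof (cases "y \<in> \<Omega>")
        case True
        have "\<bar>?V y \<bullet> H y\<bar> \<le> M * norm (H y)"
          by (rule order_trans[OF Cauchy_Schwarz_ineq2]) (simp add: M[OF True] mult_right_mono)
        then show ?thesis by linarith
      qed (simp add: that(2))
      then show "AE y in lebesgue. norm (?V y \<bullet> H y) \<le> norm (M * norm (H y))"
        by (auto intro!: AE_I2)
    qed
    have dualV: "integrable lebesgue (\<lambda>y. ?V y \<bullet> G y)"
      "(\<integral>y. ?V y \<bullet> F y \<partial>lebesgue) = (\<integral>y. ?V y \<bullet> G y \<partial>lebesgue)"
      using dual[OF V harmonic_on_newton_field[OF x\<Omega>(1)] M] by auto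
    have iF: "integrable lebesgue (\<lambda>y. ?V y \<bullet> F y)"
      by (rule intV[OF intF]) (simp add: F_def f\<Omega>_def)
    have iF': "integrable lebesgue (\<lambda>y. ?V y \<bullet> F' y)"
      by (rule intV[OF intF']) (simp add: F'_def)
    have "magnetic_potential \<Omega> f x = (\<integral>y. ?V y \<bullet> f\<Omega> y \<partial>lebesgue)"
      using magnetic_potential_eq[OF sets(1) x\<Omega>(1)] by (simp add: f\<Omega>_def)
    also have "\<dots> = (\<integral>y. ?V y \<bullet> F y \<partial>lebesgue) + (\<integral>y. ?V y \<bullet> F' y \<partial>lebesgue)"
      unfolding split inner_add_right by (rule Bochner_Integration.integral_add[OF iF iF'])
    also have "\<dots> = (\<integral>y. ?V y \<bullet> G y + ?V y \<bullet> F' y \<partial>lebesgue)"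
      unfolding dualV(2) by (rule Bochner_Integration.integral_add[OF dualV(1) iF', symmetric])
    also have "\<dots> = (\<integral>y. ?V y \<bullet> (indicator (\<Omega> - ?C) y *\<^sub>R (f y + G y)) \<partial>lebesgue)"
    proof (rule Bochner_Integration.integral_cong[OF refl])
      fix y
      show "?V y \<bullet> G y + ?V y \<bullet> F' y = ?V y \<bullet> (indicator (\<Omega> - ?C) y *\<^sub>R (f y + G y))"
        using G(3)[of y] by (cases "y \<in> \<Omega> - ?C") (auto simp: F'_def inner_add_right)
    qed
    also have "\<dots> = magnetic_potential (\<Omega> - ?C) (\<lambda>y. f y + G y) x"
      by (rule magnetic_potential_eq[OF sets(3) x\<Omega>(2), symmetric])
    finally show "magnetic_potential \<Omega> f x = magnetic_potential (\<Omega> - ?C) (\<lambda>y. f y + G y) x" .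
  qed
qed

end
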